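(* Let $G$ be a group with finite generating set $S$, and for each $k\ge 0$ let $a_k$ be the number of loops of length $k$ in $G$ with respect to $S$. Let $a$ be a generator of $\mathbb{Z}$, and let $f_k$ be the number of loops of length $k$ in $G\wr\mathbb{Z}$ with respect to the generating set $\{a\}\cup S$. There is an algorithm which, given $n$ and the numbers $a_0,a_1,\ldots,a_n$, computes $f_0,f_1,\ldots,f_n$ in time polynomial in $n$. In particular, there are polynomial-time algorithms computing the cogrowth series of the lamplighter group $\mathbb{Z}_2\wr\mathbb{Z}$, of $\mathbb{Z}\wr\mathbb{Z}$ and of $(\mathbb{Z}\wr\mathbb{Z})\wr\mathbb{Z}$.
   Context: For a group $H$ with finite generating set $T$, a loop of length $k$ in $H$ with respect to $T$ is a word of length $k$ over the alphabet $T\cup T^{-1}$ (viewed as a set of elements of $H$) that represents the identity of $H$; computing the cogrowth series means computing, given $n$, the numbers of loops of all lengths up to $n$. $G\wr\mathbb{Z}$ denotes the (restricted) wreath product $\left(\bigoplus_{i\in\mathbb{Z}}G\right)\rtimes\mathbb{Z}$, in which the generator $a$ of $\mathbb{Z}$ acts by shifting the copies of $G$; the elements of $S$ are regarded as elements of $G\wr\mathbb{Z}$ via the copy of $G$ at index $0$. In the three named examples, $\mathbb{Z}_2$ and each copy of $\mathbb{Z}$ is generated by a single standard generator, and the wreath products have the resulting generating sets $\{a\}\cup S$ (iterated in the case of $(\mathbb{Z}\wr\mathbb{Z})\wr\mathbb{Z}$). *)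

theory Defs
  imports
    "HOL-Algebra.Product_Groups"
    "HOL-Library.Log_Nat"
    "HOL-Computational_Algebra.Polynomial"
begin

section \<open>Loops and cogrowth\<close>

definition loops :: "('a, 'b) monoid_scheme \<Rightarrow> 'a set \<Rightarrow> nat \<Rightarrow> 'a list set" where
  "loops H T k =
     {w. length w = k \<and> set w \<subseteq> T \<union> m_inv H ` T \<and> foldr (\<otimes>\<^bsub>H\<^esub>) w \<one>\<^bsub>H\<^esub> = \<one>\<^bsub>H\<^esub>}"

definition num_loops :: "('a, 'b) monoid_scheme \<Rightarrow> 'a set \<Rightarrow> nat \<Rightarrow> nat" where
  "num_loops H T k = card (loops H T k)"

definition cogrowth_upto :: "('a, 'b) monoid_scheme \<Rightarrow> 'a set \<Rightarrow> nat \<Rightarrow> nat list" where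
  "cogrowth_upto H T n = map (num_loops H T) [0..<Suc n]"

definition finite_generating_set :: "('a, 'b) monoid_scheme \<Rightarrow> 'a set \<Rightarrow> bool" where
  "finite_generating_set H T \<longleftrightarrow> finite T \<and> T \<subseteq> carrier H \<and> generate H T = carrier H"


section \<open>The restricted wreath product with the integers\<close>

definition semidirect_product ::
  "('a, 'c) monoid_scheme \<Rightarrow> ('b, 'd) monoid_scheme \<Rightarrow> ('b \<Rightarrow> 'a \<Rightarrow> 'a) \<Rightarrow> ('a \<times> 'b) monoid" where
  "semidirect_product N H \<phi> =
     \<lparr>carrier = carrier N \<times> carrier H,
      monoid.mult = (\<lambda>(x, h) (y, k). (x \<otimes>\<^bsub>N\<^esub> \<phi> h y, h \<otimes>\<^bsub>H\<^esub> k)),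
      one = (\<one>\<^bsub>N\<^esub>, \<one>\<^bsub>H\<^esub>)\<rparr>"

definition shift :: "int \<Rightarrow> (int \<Rightarrow> 'a) \<Rightarrow> int \<Rightarrow> 'a" where
  "shift m x = (\<lambda>i. x (i - m))"

definition wreath_Z :: "('a, 'b) monoid_scheme \<Rightarrow> ((int \<Rightarrow> 'a) \<times> int) monoid" where
  "wreath_Z G = semidirect_product (sum_group UNIV (\<lambda>_. G)) integer_group shift"

definition wreath_base :: "('a, 'b) monoid_scheme \<Rightarrow> 'a \<Rightarrow> (int \<Rightarrow> 'a) \<times> int" where
  "wreath_base G s = ((\<lambda>i. if i = 0 then s else \<one>\<^bsub>G\<^esub>), 0)"

definition wreath_top :: "('a, 'b) monoid_scheme \<Rightarrow> int \<Rightarrow> (int \<Rightarrow> 'a) \<times> int" where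
  "wreath_top G z = ((\<lambda>_. \<one>\<^bsub>G\<^esub>), z)"

definition wreath_gens ::
  "('a, 'b) monoid_scheme \<Rightarrow> int \<Rightarrow> 'a set \<Rightarrow> ((int \<Rightarrow> 'a) \<times> int) set" where
  "wreath_gens G z S = insert (wreath_top G z) (wreath_base G ` S)"


section \<open>Algorithms and their running time\<close>

text \<open>
  The machine model is the random access machine on natural numbers of unbounded size under the
  logarithmic cost criterion (Cook and Reckhow; Aho, Hopcroft and Ullman), with structured
  control flow. Every access to a constant, an address or an operand is charged its number of
  binary digits, so that polynomial running time agrees with that of Turing machines.
  Subtraction is truncated at 0, and division rounds down, with \<open>x div 0 = 0\<close>.
\<close>

type_synonym mem = "nat \<Rightarrow> nat"

abbreviation bits :: "nat \<Rightarrow> nat" where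
  "bits x \<equiv> floorlog 2 x"

datatype expr =
    Const nat
  | Load expr
  | Add expr expr
  | Sub expr expr
  | Mul expr expr
  | Div expr expr

datatype prog =
    Skip
  | Store expr expr
  | Seq prog prog
  | Cond expr prog prog
  | While expr prog

fun val :: "expr \<Rightarrow> mem \<Rightarrow> nat" where
  "val (Const c) m = c"
| "val (Load e) m = m (val e m)"
| "val (Add e e') m = val e m + val e' m"
| "val (Sub e e') m = val e m - val e' m"
| "val (Mul e e') m = val e m * val e' m"
| "val (Div e e') m = val e m div val e' m"

fun cost :: "expr \<Rightarrow> mem \<Rightarrow> nat" where
  "cost (Const c) m = 1 + bits c"
| "cost (Load e) m = cost e m + 1 + bits (val e m) + bits (m (val e m))"
| "cost (Add e e') m = cost e m + cost e' m + 1 + bits (val e m) + bits (val e' m)"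
| "cost (Sub e e') m = cost e m + cost e' m + 1 + bits (val e m) + bits (val e' m)"
| "cost (Mul e e') m = cost e m + cost e' m + 1 + bits (val e m) + bits (val e' m)"
| "cost (Div e e') m = cost e m + cost e' m + 1 + bits (val e m) + bits (val e' m)"

text \<open>
  \<open>exec P m t m'\<close>: started on memory \<open>m\<close>, program \<open>P\<close> halts after time \<open>t\<close> with memory \<open>m'\<close>.
  A test succeeds iff its value is not 0.
\<close>

inductive exec :: "prog \<Rightarrow> mem \<Rightarrow> nat \<Rightarrow> mem \<Rightarrow> bool" where
  Skip: "exec Skip m 1 m"
| Store: "exec (Store a e) m
     (cost a m + cost e m + 1 + bits (val a m) + bits (val e m)) (m(val a m := val e m))"
| Seq: "exec P m t m' \<Longrightarrow> exec Q m' t' m'' \<Longrightarrow> exec (Seq P Q) m (t + t') m''"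
| CondT: "val b m \<noteq> 0 \<Longrightarrow> exec P m t m' \<Longrightarrow>
     exec (Cond b P Q) m (cost b m + 1 + bits (val b m) + t) m'"
| CondF: "val b m = 0 \<Longrightarrow> exec Q m t m' \<Longrightarrow> exec (Cond b P Q) m (cost b m + 1 + t) m'"
| WhileT: "val b m \<noteq> 0 \<Longrightarrow> exec P m t m' \<Longrightarrow> exec (While b P) m' t' m'' \<Longrightarrow>
     exec (While b P) m (cost b m + 1 + bits (val b m) + t + t') m''"
| WhileF: "val b m = 0 \<Longrightarrow> exec (While b P) m (cost b m + 1) m"

definition init_mem :: "nat list \<Rightarrow> mem" where
  "init_mem xs i = (if i < length xs then xs ! i else 0)"

text \<open>The output is read off the initial segment of the final memory.\<close>

definition computes_in_time :: "prog \<Rightarrow> nat list \<Rightarrow> nat list \<Rightarrow> nat \<Rightarrow> bool" where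
  "computes_in_time P xs ys b \<longleftrightarrow>
     (\<exists>t m. exec P (init_mem xs) t m \<and> map m [0..<length ys] = ys \<and> t \<le> b)"

text \<open>
  \<open>P\<close> computes, for every \<open>n\<close>, the output \<open>out n\<close> from the input \<open>inp n\<close>, in time polynomial in
  the number \<open>n\<close> itself (not in its number of digits).
\<close>

definition computes_in_poly_time :: "prog \<Rightarrow> (nat \<Rightarrow> nat list) \<Rightarrow> (nat \<Rightarrow> nat list) \<Rightarrow> bool" where
  "computes_in_poly_time P inp out \<longleftrightarrow>
     (\<exists>p :: nat poly. \<forall>n. computes_in_time P (inp n) (out n) (poly p n))"

definition poly_time_cogrowth :: "('a, 'b) monoid_scheme \<Rightarrow> 'a set \<Rightarrow> bool" where
  "poly_time_cogrowth H T \<longleftrightarrow> (\<exists>P. computes_in_poly_time P (\<lambda>n. [n]) (cogrowth_upto H T))"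

end

theory Submission
  imports Defs
begin

text \<open>
  A loop in the wreath product is a closed path on the integers such that at every height the
  letters written there, in order, form a loop in \<open>G\<close>. So the number of loops depends on \<open>G\<close> only
  through the numbers \<open>a\<^sub>j\<close>. Paths are cut height by height. Let \<open>E(p, m)\<close> count the sequences of
  \<open>p\<close> nonnegative excursions, each followed by a separator, of total length \<open>m\<close>, with a loop at every
  height. If \<open>p + 1\<close> excursions have \<open>q\<close> up-steps from height 0 and \<open>j\<close> letters at height 0, then the
  part at height at least 1 is a sequence of \<open>q\<close> excursions whose separators are the returns to
  height 0, and it can be chosen independently of the part at height 0. Hence
  \<open>E(p + 1, m + 1)\<close> is the sum, over all \<open>q, j\<close> with \<open>p + q + j \<le> m\<close>, of
  \<open>(p + q + j)! / (p! q! j!) a\<^sub>j E(q, m - p - q - j)\<close>.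
  Cutting a closed path between heights -1 and 0 gives
  \<open>f\<^sub>k = (\<Sum>p, m. E(p + 1, m + 1) E(p, k - m))\<close>, where \<open>p\<close> is the number of steps down from height 0.
  The numbers involved have polynomially many digits, so these recursions can be evaluated in
  polynomial time. Since the integers are the wreath product of the trivial group with the
  integers, the examples follow by iterating the program.
\<close>

section \<open>Words over steps and letters\<close>

text \<open>A step is always attributed to the height where it starts. When a path is cut above
  height 0, the step leaving height 0 stays below the cut, while the step returning from height 1
  goes above it and becomes a separator there; so the upper part is again a tuple and the recursion
  closes up. The separator after the last excursion makes it well founded: row \<open>m + 1\<close>
  of E refers only to rows up to \<open>m\<close>, even for \<open>p = q = j = 0\<close>. On the
  machine side, one program has to serve all groups, while the size of the numbers depends on the
  generating set. Time is therefore counted in units \<open>bits V + 1\<close> for a bound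
  \<open>V\<close> on all stored numbers: the number of units depends on \<open>n\<close> alone, and
  the group enters only through \<open>V\<close>. All sums have nonnegative terms, so partial sums
  never exceed the final values, and these are at most the number of words of the given
  length.\<close>

datatype 'a step = Up | Down | Letter 'a

fun letters :: "'a step list \<Rightarrow> 'a list" where
  "letters [] = []"
| "letters (Letter b # v) = b # letters v"
| "letters (_ # v) = letters v"

text \<open>
  A word is read as a path on the natural numbers that is reflected at height 0. A \<open>Down\<close> at
  height 0 acts as a separator between excursions.
\<close>

fun next_height :: "nat \<Rightarrow> 'a step \<Rightarrow> nat" where
  "next_height h Up = Suc h"
| "next_height h Down = h - 1"
| "next_height h (Letter b) = h"

fun level :: "nat \<Rightarrow> 'a step list \<Rightarrow> nat \<Rightarrow> 'a list" where
  "level h [] i = []"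
| "level h (Letter b # v) i = (if i = h then b # level h v i else level h v i)"
| "level h (s # v) i = level (next_height h s) v i"

fun ground :: "nat \<Rightarrow> 'a step list \<Rightarrow> 'a step list" where
  "ground h [] = []"
| "ground h (s # v) = (if h = 0 then s # ground (next_height h s) v else ground (next_height h s) v)"

fun above :: "nat \<Rightarrow> 'a step list \<Rightarrow> 'a step list" where
  "above h [] = []"
| "above h (s # v) = (if h = 0 then above (next_height h s) v else s # above (next_height h s) v)"

text \<open>The current height tells which of the two words supplies the next step, so the
  interleaving need not be recorded. The result ends when that word is exhausted; for compatible
  tuples this happens only at the very end.\<close>

fun merge :: "nat \<Rightarrow> 'a step list \<Rightarrow> 'a step list \<Rightarrow> 'a step list" where
  "merge 0 [] v = []"
| "merge 0 (s # u) v = s # merge (next_height 0 s) u v"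
| "merge (Suc h) u [] = []"
| "merge (Suc h) u (s # v) = s # merge (next_height (Suc h) s) u v"

text \<open>
  From height 0, a closed tuple consists of \<open>p\<close> excursions, each followed by a separator; an open
  tuple consists of \<open>p + 1\<close> excursions with separators between them.
\<close>

fun closed_tuple :: "nat \<Rightarrow> nat \<Rightarrow> 'a step list \<Rightarrow> bool" where
  "closed_tuple p h [] \<longleftrightarrow> p = 0 \<and> h = 0"
| "closed_tuple p h (Up # v) \<longleftrightarrow> p > 0 \<and> closed_tuple p (Suc h) v"
| "closed_tuple p h (Down # v) \<longleftrightarrow>
     p > 0 \<and> (if h = 0 then closed_tuple (p - 1) 0 v else closed_tuple p (h - 1) v)"
| "closed_tuple p h (Letter b # v) \<longleftrightarrow> p > 0 \<and> closed_tuple p h v"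

fun open_tuple :: "nat \<Rightarrow> nat \<Rightarrow> 'a step list \<Rightarrow> bool" where
  "open_tuple p h [] \<longleftrightarrow> p = 0 \<and> h = 0"
| "open_tuple p h (Up # v) \<longleftrightarrow> open_tuple p (Suc h) v"
| "open_tuple p h (Down # v) \<longleftrightarrow>
     (if h = 0 then p > 0 \<and> open_tuple (p - 1) 0 v else open_tuple p (h - 1) v)"
| "open_tuple p h (Letter b # v) \<longleftrightarrow> open_tuple p h v"

section \<open>Closed and open tuples\<close>

lemma closed_tuple_0 [simp]: "closed_tuple 0 h v \<longleftrightarrow> v = [] \<and> h = 0"
  by (cases "(0::nat, h, v)" rule: closed_tuple.cases) auto

text \<open>The two kinds of tuple differ by the separator after the last excursion. Removing it
  turns counts of closed tuples into counts of open ones, with index and length both lowered by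
  one.\<close>

lemma closed_tuple_snoc: "closed_tuple (Suc p) h (u @ [Down]) \<longleftrightarrow> open_tuple p h u"
proof (induction p h u rule: open_tuple.induct)
  case (3 p h v)
  then show ?case by (cases p) auto
qed auto

lemma closed_tuple_ends_Down: "closed_tuple p h v \<Longrightarrow> p > 0 \<Longrightarrow> \<exists>u. v = u @ [Down]"
proof (induction p h v rule: closed_tuple.induct)
  case (3 p h v)
  then show ?case by (cases "p = 1") (auto split: if_splits)
qed auto

lemma level_snoc_Down: "level h (u @ [Down]) i = level h u i"
  by (induction h u i rule: level.induct) auto

text \<open>The index \<open>p\<close> is the number of \<open>Down\<close> steps at height 0, hence
  a function of the word; this makes the sets indexed by \<open>p\<close> disjoint.\<close>

lemma open_tuple_unique: "open_tuple p h v \<Longrightarrow> open_tuple p' h v \<Longrightarrow> p = p'"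
proof (induction p h v arbitrary: p' rule: open_tuple.induct)
  case (3 p h v)
  then show ?case by (auto split: if_splits) (metis Suc_pred)
qed auto

lemma open_tuple_le: "open_tuple p h v \<Longrightarrow> p \<le> length v"
  by (induction p h v rule: open_tuple.induct) (auto split: if_splits)

section \<open>Cutting a tuple above height 0\<close>

lemma merge_ground_above: "merge h (ground h v) (above h v) = v"
proof (induction v arbitrary: h)
  case (Cons s v)
  then show ?case by (cases h) auto
qed (case_tac h; simp)

lemma set_ground_above: "set (ground h v) \<union> set (above h v) = set v"
proof (induction v arbitrary: h)
  case (Cons s v)
  show ?case using Cons[of "next_height h s"] by auto
qed simp

lemma length_ground_above: "length (ground h v) + length (above h v) = length v"
  by (induction h v rule: ground.induct) auto

lemma length_conv_counts:
  "length u = count_list u Down + count_list u Up + length (letters u)"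
  by (induction u rule: letters.induct) auto

lemma level_0: "level h v 0 = letters (ground h v)"
  by (induction h v "0::nat" rule: level.induct) auto

text \<open>Truncated subtraction matters: while \<open>v\<close> is at height 0, the word
  \<open>above h v\<close> also waits at height 0, since the \<open>Down\<close> from height 1 that
  brought \<open>v\<close> there acts as a separator in it.\<close>

lemma level_Suc: "level h v (Suc i) = level (h - 1) (above h v) i"
proof (induction v arbitrary: h)
  case (Cons s v)
  then show ?case by (cases s; cases h) auto
qed simp

lemma count_Down_ground: "open_tuple p h v \<Longrightarrow> count_list (ground h v) Down = p"
  by (induction p h v rule: open_tuple.induct) (auto split: if_splits)

text \<open>Every \<open>Up\<close> still to come in the ground word opens one excursion of the
  upper word. If \<open>h\<close> is positive, one more is under way.\<close>

lemma closed_tuple_above: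
  "open_tuple p h v \<Longrightarrow>
    closed_tuple (count_list (ground h v) Up + (if h = 0 then 0 else 1)) (h - 1) (above h v)"
proof (induction p h v rule: open_tuple.induct)
  case (3 p h v)
  then show ?case by (cases "h = 1") (auto split: if_splits)
qed (auto split: if_splits)

text \<open>The number of excursions is the only condition that links the two parts; any ground word
  may be combined with any closed tuple of the right index.\<close>

lemma tuple_merge:
  "closed_tuple (count_list u Up + (if h = 0 then 0 else 1)) (h - 1) v \<Longrightarrow>
    open_tuple (count_list u Down) h (merge h u v) \<and>
    ground h (merge h u v) = u \<and> above h (merge h u v) = v"
proof (induction h u v rule: merge.induct)
  case (2 s u v)
  then show ?case by (cases s) auto
next
  case (4 h u s v)
  then show ?case by (cases s; cases h) auto
qed auto

text \<open>Words are also read as paths on the integers, and are cut between heights -1 and 0.\<close>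

fun znext_height :: "int \<Rightarrow> 'a step \<Rightarrow> int" where
  "znext_height h Up = h + 1"
| "znext_height h Down = h - 1"
| "znext_height h (Letter b) = h"

fun zend :: "int \<Rightarrow> 'a step list \<Rightarrow> int" where
  "zend h [] = h"
| "zend h (s # w) = zend (znext_height h s) w"

fun zlevel :: "int \<Rightarrow> 'a step list \<Rightarrow> int \<Rightarrow> 'a list" where
  "zlevel h [] i = []"
| "zlevel h (Letter b # v) i = (if i = h then b # zlevel h v i else zlevel h v i)"
| "zlevel h (s # v) i = zlevel (znext_height h s) v i"

text \<open>Reflecting heights by \<open>i\<close> to \<open>- 1 - i\<close> turns the part of a
  path below 0 into a path on the natural numbers, and exchanges the two directions.\<close>

fun flip :: "'a step \<Rightarrow> 'a step" where
  "flip Up = Down"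
| "flip Down = Up"
| "flip (Letter b) = Letter b"

lemma flip_flip [simp]: "flip (flip s) = s"
  by (cases s) auto

fun upper :: "int \<Rightarrow> 'a step list \<Rightarrow> 'a step list" where
  "upper h [] = []"
| "upper h (s # w) = (if h \<ge> 0 then s # upper (znext_height h s) w else upper (znext_height h s) w)"

text \<open>An excursion below 0 starts with a \<open>Down\<close> from height 0, which belongs to
  \<open>upper\<close>, and ends with an \<open>Up\<close> from height -1, which belongs here and is
  flipped to a separator. Hence the upper word becomes an open tuple and the lower word a closed
  one.\<close>

fun lower :: "int \<Rightarrow> 'a step list \<Rightarrow> 'a step list" where
  "lower h [] = []"
| "lower h (s # w) =
     (if h \<ge> 0 then lower (znext_height h s) w else flip s # lower (znext_height h s) w)"

fun zmerge :: "int \<Rightarrow> 'a step list \<Rightarrow> 'a step list \<Rightarrow> 'a step list" where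
  "zmerge h [] [] = []"
| "zmerge h (s # u) [] = (if h \<ge> 0 then s # zmerge (znext_height h s) u [] else [])"
| "zmerge h [] (s # v) =
     (if h \<ge> 0 then [] else flip s # zmerge (znext_height h (flip s)) [] v)"
| "zmerge h (s # u) (t # v) =
     (if h \<ge> 0 then s # zmerge (znext_height h s) u (t # v)
      else flip t # zmerge (znext_height h (flip t)) (s # u) v)"

lemma zmerge_nonneg: "h \<ge> 0 \<Longrightarrow> zmerge h (s # u) v = s # zmerge (znext_height h s) u v"
  by (cases v) auto

lemma zmerge_neg: "h < 0 \<Longrightarrow> zmerge h u (s # v) = flip s # zmerge (znext_height h (flip s)) u v"
  by (cases u) auto

section \<open>Cutting a path on the integers between heights -1 and 0\<close>

lemma zmerge_upper_lower: "zmerge h (upper h w) (lower h w) = w"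
  by (induction w arbitrary: h) (auto simp: zmerge_nonneg zmerge_neg)

lemma length_upper_lower: "length (upper h w) + length (lower h w) = length w"
  by (induction w arbitrary: h) auto

lemma set_upper_lower: "set w = set (upper h w) \<union> flip ` set (lower h w)"
proof (induction w arbitrary: h)
  case (Cons s w)
  show ?case using Cons[of "znext_height h s"] by auto
qed simp

text \<open>While the path is below 0, \<open>nat h\<close> is 0: the upper word has passed a
  separator and waits at height 0.\<close>

lemma zlevel_nonneg: "zlevel h w (int i) = level (nat h) (upper h w) i"
proof (induction w arbitrary: h)
  case (Cons s w)
  show ?case
  proof (cases s)
    case Up
    then show ?thesis using Cons[of "h + 1"] by (auto simp: nat_add_distrib)
  next
    case Down
    have "nat (h - 1) = nat h - 1" by auto
    then show ?thesis using Down Cons[of "h - 1"] by auto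
  qed (use Cons[of h] in auto)
qed simp

lemma zlevel_neg: "zlevel h w (- 1 - int i) = level (nat (- 1 - h)) (lower h w) i"
proof (induction w arbitrary: h)
  case (Cons s w)
  show ?case
  proof (cases s)
    case Up
    have "h < 0 \<Longrightarrow> nat (- 1 - (h + 1)) = nat (- 1 - h) - 1" by auto
    then show ?thesis using Up Cons[of "h + 1"] by auto
  next
    case Down
    have "h < 0 \<Longrightarrow> nat (- 1 - (h - 1)) = Suc (nat (- 1 - h))" by auto
    then show ?thesis using Down Cons[of "h - 1"] by auto
  qed (use Cons[of h] in auto)
qed simp

text \<open>Here \<open>p\<close> counts the separators of the upper word still to come. Each of
  them opens an excursion of the lower word; below 0 one such excursion is already running, hence
  \<open>Suc p\<close>.\<close>

lemma tuples_upper_lower: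
  "zend h w = 0 \<Longrightarrow>
    \<exists>p. if h \<ge> 0 then open_tuple p (nat h) (upper h w) \<and> closed_tuple p 0 (lower h w)
        else open_tuple p 0 (upper h w) \<and> closed_tuple (Suc p) (nat (- 1 - h)) (lower h w)"
proof (induction w arbitrary: h)
  case (Cons s w)
  have IH: "\<exists>p. if h' \<ge> 0 then open_tuple p (nat h') (upper h' w) \<and> closed_tuple p 0 (lower h' w)
        else open_tuple p 0 (upper h' w) \<and> closed_tuple (Suc p) (nat (- 1 - h')) (lower h' w)"
    if "h' = znext_height h s" for h'
    using Cons.IH[of h'] Cons.prems that by simp
  show ?case
  proof (cases s)
    case Up
    have "nat (h + 1) = Suc (nat h)" if "h \<ge> 0" using that by auto
    moreover have "nat (- 1 - h) = 0" if "h = -1" using that by auto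
    moreover have "nat (- 1 - (h + 1)) = nat (- 1 - h) - 1" by auto
    moreover have "nat (- 1 - h) \<noteq> 0" if "h < -1" using that by auto
    ultimately show ?thesis using IH[of "h + 1"] Up
      by (cases "h \<ge> 0"; cases "h = -1") (auto split: if_splits)
  next
    case Down
    consider "h > 0" | "h = 0" | "h < 0" by linarith
    then show ?thesis
    proof cases
      case 1
      then have "nat (h - 1) = nat h - 1" "nat h \<noteq> 0" by auto
      then show ?thesis using 1 IH[of "h - 1"] Down by auto
    next
      case 2
      then obtain p where "open_tuple p 0 (upper (- 1) w)" "closed_tuple (Suc p) 0 (lower (- 1) w)"
        using IH[of "- 1"] Down by auto
      \<comment> \<open>The step just taken is itself a separator of the upper word, so the count
        rises by one.\<close>
      then show ?thesis using 2 Down by (intro exI[of _ "Suc p"]) auto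
    next
      case 3
      then have "nat (- 1 - (h - 1)) = Suc (nat (- 1 - h))" by auto
      then show ?thesis using 3 IH[of "h - 1"] Down by auto
    qed
  next
    case (Letter b)
    then show ?thesis using IH[of h] by (auto split: if_splits)
  qed
qed auto

text \<open>The induction is on the total length because each round shortens either one of the two
  words.\<close>

lemma tuples_zmerge:
  assumes "if h \<ge> 0 then open_tuple p (nat h) u \<and> closed_tuple p 0 v
           else open_tuple p 0 u \<and> closed_tuple (Suc p) (nat (- 1 - h)) v"
  shows "zend h (zmerge h u v) = 0 \<and> upper h (zmerge h u v) = u \<and> lower h (zmerge h u v) = v"
  using assms
proof (induction "length u + length v" arbitrary: h p u v)
  case 0
  then show ?case by (auto split: if_splits)
next
  case (Suc l)
  show ?case
  proof (cases "h \<ge> 0")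
    case True
    then have t: "open_tuple p (nat h) u" "closed_tuple p 0 v" using Suc.prems by auto
    show ?thesis
    proof (cases u)
      case Nil
      then show ?thesis using t True Suc.hyps(2) by auto
    next
      case (Cons s u')
      have "zend (znext_height h s) (zmerge (znext_height h s) u' v) = 0 \<and>
          upper (znext_height h s) (zmerge (znext_height h s) u' v) = u' \<and>
          lower (znext_height h s) (zmerge (znext_height h s) u' v) = v"
      \<comment> \<open>Crossing from 0 to -1 uses up one separator of \<open>u\<close>; every other
        step leaves the count unchanged.\<close>
      proof (rule Suc.hyps(1)[where p = "if s = Down \<and> h = 0 then p - 1 else p"])
        show "l = length u' + length v" using Suc.hyps(2) Cons by simp
        have "nat (h + 1) = Suc (nat h)" using True by auto
        moreover have "nat (h - 1) = nat h - 1" by auto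
        ultimately show "if 0 \<le> znext_height h s
          then open_tuple (if s = Down \<and> h = 0 then p - 1 else p) (nat (znext_height h s)) u' \<and>
               closed_tuple (if s = Down \<and> h = 0 then p - 1 else p) 0 v
          else open_tuple (if s = Down \<and> h = 0 then p - 1 else p) 0 u' \<and>
               closed_tuple (Suc (if s = Down \<and> h = 0 then p - 1 else p))
                 (nat (- 1 - znext_height h s)) v"
          using t True Cons by (cases s) (auto split: if_splits)
      qed
      then show ?thesis using True Cons by (simp add: zmerge_nonneg)
    qed
  next
    case False
    then have t: "open_tuple p 0 u" "closed_tuple (Suc p) (nat (- 1 - h)) v" using Suc.prems by auto
    then obtain s v' where v: "v = s # v'" by (cases v) auto
    have "zend (znext_height h (flip s)) (zmerge (znext_height h (flip s)) u v') = 0 \<and>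
        upper (znext_height h (flip s)) (zmerge (znext_height h (flip s)) u v') = u \<and>
        lower (znext_height h (flip s)) (zmerge (znext_height h (flip s)) u v') = v'"
    proof (rule Suc.hyps(1)[where p = p])
      show "l = length u + length v'" using Suc.hyps(2) v by simp
      have "nat (- 1 - (h - 1)) = Suc (nat (- 1 - h))" using False by auto
      moreover have "nat (- 1 - (h + 1)) = nat (- 1 - h) - 1" by auto
      ultimately show "if 0 \<le> znext_height h (flip s)
        then open_tuple p (nat (znext_height h (flip s))) u \<and> closed_tuple p 0 v'
        else open_tuple p 0 u \<and> closed_tuple (Suc p) (nat (- 1 - znext_height h (flip s))) v'"
        using t False v by (cases s) (auto split: if_splits)
    qed
    then show ?thesis using False v by (simp add: zmerge_neg)
  qed
qed

section \<open>Counting words levelwise\<close>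

text \<open>Abstracts from the group: \<open>L\<close> will be the set of words over
  \<open>B\<close> that represent the identity. The empty word is in \<open>L\<close> because it is
  what heights never visited contribute.\<close>

locale language =
  fixes B :: "'a set" and L :: "'a list set"
  assumes finite_letters: "finite B"
    and Nil_in: "[] \<in> L"
    and lists: "L \<subseteq> lists B"
begin

definition alphabet :: "'a step set" where
  "alphabet = {Up, Down} \<union> Letter ` B"

definition words :: "nat \<Rightarrow> 'a step list set" where
  "words m = {v. set v \<subseteq> alphabet \<and> length v = m}"

definition num :: "nat \<Rightarrow> nat" where
  "num j = card {l \<in> L. length l = j}"

definition open_words :: "nat \<Rightarrow> nat \<Rightarrow> 'a step list set" where
  "open_words p m = {v \<in> words m. open_tuple p 0 v \<and> (\<forall>i. level 0 v i \<in> L)}"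

definition closed_words :: "nat \<Rightarrow> nat \<Rightarrow> 'a step list set" where
  "closed_words p m = {v \<in> words m. closed_tuple p 0 v \<and> (\<forall>i. level 0 v i \<in> L)}"

definition closed_paths :: "nat \<Rightarrow> 'a step list set" where
  "closed_paths k = {w \<in> words k. zend 0 w = 0 \<and> (\<forall>i. zlevel 0 w i \<in> L)}"

text \<open>The ground words of open tuples: \<open>p\<close> separators, \<open>q\<close>
  departures to height 1 and \<open>j\<close> letters at height 0.\<close>

definition skeletons :: "nat \<Rightarrow> nat \<Rightarrow> nat \<Rightarrow> 'a step list set" where
  "skeletons p q j = {u. set u \<subseteq> alphabet \<and> count_list u Down = p \<and> count_list u Up = q \<and>
     letters u \<in> L \<and> length (letters u) = j}"

lemma card_alphabet: "card alphabet = card B + 2"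
  unfolding alphabet_def
  by (subst card_Un_disjoint) (auto simp: finite_letters card_image inj_on_def)

lemma finite_alphabet: "finite alphabet"
  by (simp add: alphabet_def finite_letters)

lemma finite_words: "finite (words m)"
  unfolding words_def by (rule finite_lists_length_eq[OF finite_alphabet])

lemma card_words: "card (words m) = (card B + 2) ^ m"
  unfolding words_def by (simp add: card_lists_length_eq[OF finite_alphabet] card_alphabet)

lemma finite_open_words: "finite (open_words p m)"
  by (rule finite_subset[OF _ finite_words[of m]]) (auto simp: open_words_def)

lemma finite_closed_words: "finite (closed_words p m)"
  by (rule finite_subset[OF _ finite_words[of m]]) (auto simp: closed_words_def)

lemma card_closed_words_le: "card (closed_words p m) \<le> (card B + 2) ^ m"
  unfolding card_words[symmetric]
  by (intro card_mono finite_words) (auto simp: closed_words_def)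

lemma card_closed_paths_le: "card (closed_paths k) \<le> (card B + 2) ^ k"
  unfolding card_words[symmetric]
  by (intro card_mono finite_words) (auto simp: closed_paths_def)

lemma finite_L_length: "finite {l \<in> L. length l = j}"
  by (rule finite_subset[OF _ finite_lists_length_eq[OF finite_letters, of j]])
    (use lists in \<open>auto simp: in_lists_conv_set\<close>)

text \<open>The base is that of the bounds on words with steps, so that a single bound covers the
  inputs as well as all computed numbers.\<close>

lemma num_le: "num j \<le> (card B + 2) ^ j"
proof -
  have "num j \<le> card {l. set l \<subseteq> B \<and> length l = j}"
    unfolding num_def by (intro card_mono finite_lists_length_eq finite_letters)
      (use lists in \<open>auto simp: in_lists_conv_set\<close>)
  also have "\<dots> \<le> (card B + 2) ^ j"
    by (simp add: card_lists_length_eq finite_letters power_mono)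
  finally show ?thesis .
qed

section \<open>Recursion for tuples and the formula for closed paths\<close>

lemma card_UN_const:
  assumes "finite I" "\<And>i. i \<in> I \<Longrightarrow> finite (f i)" "\<And>i. i \<in> I \<Longrightarrow> card (f i) = c"
    and "\<And>i j x. i \<in> I \<Longrightarrow> j \<in> I \<Longrightarrow> x \<in> f i \<Longrightarrow> x \<in> f j \<Longrightarrow> i = j"
  shows "card (\<Union>i\<in>I. f i) = card I * c"
  by (subst card_UN_disjoint) (use assms in auto)

text \<open>A skeleton is a shuffle of a word in \<open>L\<close> with a shuffle of \<open>p\<close>
  copies of \<open>Down\<close> and \<open>q\<close> copies of \<open>Up\<close>. Filtering by kind
  of symbol recovers the ingredients, so the shuffles for different ingredients are disjoint and the
  count is a product of two binomial coefficients.\<close>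

lemma card_skeletons:
  "card (skeletons p q j) = fact (p + q + j) div (fact p * fact q * fact j) * num j"
proof -
  let ?T = "shuffles (replicate p Down) (replicate q Up) :: 'a step list set"
  let ?f = "\<lambda>(l, t). shuffles (map Letter l) t"
  have T: "set t \<subseteq> {Up, Down}" "length t = p + q" "count_list t Down = p" "count_list t Up = q"
    if "t \<in> ?T" for t
  proof -
    show "set t \<subseteq> {Up, Down}" using set_shuffles[OF that] by auto
    show "length t = p + q" using length_shuffles[OF that] by simp
    have "mset t = mset (replicate p Down) + mset (replicate q Up)"
      by (rule mset_shuffles[OF that])
    then have "count (mset t) Down = p" "count (mset t) Up = q" by simp_all
    then show "count_list t Down = p" "count_list t Up = q"
      by (simp_all add: count_mset count_list_eq_length_filter)
  qed
  have disj: "set (map Letter l) \<inter> set t = {}" if "t \<in> ?T" for l t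
    using T(1)[OF that] by auto
  have sh: "filter (\<lambda>s. s \<noteq> Up \<and> s \<noteq> Down) u = map Letter l" "filter (\<lambda>s. s = Up \<or> s = Down) u = t"
    if "t \<in> ?T" "u \<in> shuffles (map Letter l) t" for l t u
  proof -
    have s: "set u = set (map Letter l) \<union> set t" by (rule set_shuffles[OF that(2)])
    have "filter (\<lambda>s. s \<noteq> Up \<and> s \<noteq> Down) u = filter (\<lambda>s. s \<in> set (map Letter l)) u"
      by (rule filter_cong) (use s T(1)[OF that(1)] in auto)
    then show "filter (\<lambda>s. s \<noteq> Up \<and> s \<noteq> Down) u = map Letter l"
      using filter_shuffles_disjoint1(1)[OF disj[OF that(1)] that(2)] by simp
    have "filter (\<lambda>s. s = Up \<or> s = Down) u = filter (\<lambda>s. s \<notin> set (map Letter l)) u"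
      by (rule filter_cong) (use s T(1)[OF that(1)] in auto)
    then show "filter (\<lambda>s. s = Up \<or> s = Down) u = t"
      using filter_shuffles_disjoint1(2)[OF disj[OF that(1)] that(2)] by simp
  qed
  have letters_filter: "map Letter (letters u) = filter (\<lambda>s. s \<noteq> Up \<and> s \<noteq> Down) u" for u :: "'a step list"
    by (induction u rule: letters.induct) auto
  have count_filter: "count_list (filter (\<lambda>s. s = Up \<or> s = Down) u) Down = count_list u Down"
    "count_list (filter (\<lambda>s. s = Up \<or> s = Down) u) Up = count_list u Up" for u :: "'a step list"
    by (induction u) auto
  have in_T: "t \<in> ?T" if "set t \<subseteq> {Up, Down}" "count_list t Down = p" "count_list t Up = q" for t
  proof -
    have "filter (\<lambda>s. s = Down) t = replicate p Down" "filter (\<lambda>s. \<not> s = Down) t = replicate q Up"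
      using that(2,3) that(1)
      by (induction t arbitrary: p q) auto
    then show ?thesis using partition_in_shuffles[of t "\<lambda>s. s = Down"] by simp
  qed
  have eq: "skeletons p q j = (\<Union>x\<in>{l \<in> L. length l = j} \<times> ?T. ?f x)"
  proof (intro equalityI subsetI)
    fix u assume u: "u \<in> skeletons p q j"
    have "u \<in> shuffles (map Letter (letters u)) (filter (\<lambda>s. s = Up \<or> s = Down) u)"
      using partition_in_shuffles[of u "\<lambda>s. s \<noteq> Up \<and> s \<noteq> Down"] by (simp add: letters_filter)
    moreover have "filter (\<lambda>s. s = Up \<or> s = Down) u \<in> ?T"
      by (rule in_T) (use u in \<open>auto simp: count_filter skeletons_def\<close>)
    ultimately show "u \<in> (\<Union>x\<in>{l \<in> L. length l = j} \<times> ?T. ?f x)"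
      using u by (auto simp: skeletons_def)
  next
    fix u assume "u \<in> (\<Union>x\<in>{l \<in> L. length l = j} \<times> ?T. ?f x)"
    then obtain l t where lt: "l \<in> L" "length l = j" "t \<in> ?T" "u \<in> shuffles (map Letter l) t"
      by auto
    have "map Letter (letters u) = map Letter l" using sh(1)[OF lt(3,4)] letters_filter[of u] by simp
    then have "letters u = l" by (simp add: inj_map_eq_map inj_def)
    moreover have "count_list u Down = p" "count_list u Up = q"
      using count_filter[of u] sh(2)[OF lt(3,4)] T(3,4)[OF lt(3)] by simp_all
    moreover have "set u \<subseteq> alphabet"
      using set_shuffles[OF lt(4)] T(1)[OF lt(3)] lists lt(1)
      by (auto simp: alphabet_def in_lists_conv_set)
    ultimately show "u \<in> skeletons p q j" using lt by (simp add: skeletons_def)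
  qed
  have "card (skeletons p q j) = card ({l \<in> L. length l = j} \<times> ?T) * (j + (p + q) choose j)"
    unfolding eq
  proof (rule card_UN_const)
    show "finite ({l \<in> L. length l = j} \<times> ?T)" using finite_L_length by simp
  next
    fix x assume "x \<in> {l \<in> L. length l = j} \<times> ?T"
    then obtain l t where x: "x = (l, t)" "l \<in> L" "length l = j" "t \<in> ?T" by auto
    then show "card (?f x) = (j + (p + q) choose j)"
      using card_disjoint_shuffles[OF disj[OF x(4)]] T(2)[OF x(4)] by simp
  next
    fix x y u assume xy: "x \<in> {l \<in> L. length l = j} \<times> ?T" "y \<in> {l \<in> L. length l = j} \<times> ?T"
      "u \<in> ?f x" "u \<in> ?f y"
    obtain l t l' t' where x: "x = (l, t)" "t \<in> ?T" "y = (l', t')" "t' \<in> ?T"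
      using xy by auto
    then have "map Letter l = map Letter l'" "t = t'"
      using sh[of t u l] sh[of t' u l'] xy by auto
    then show "x = y" using x by (simp add: inj_map_eq_map inj_def)
  qed auto
  also have "card ({l \<in> L. length l = j} \<times> ?T) = num j * (p + q choose p)"
  proof -
    have "set (replicate p (Down :: 'a step)) \<inter> set (replicate q Up) = {}" by (auto simp: set_replicate_conv_if)
    from card_disjoint_shuffles[OF this] show ?thesis
      by (simp add: card_cartesian_product num_def)
  qed
  also have "num j * (p + q choose p) * (j + (p + q) choose j) =
      (p + q choose p) * (p + q + j choose j) * num j" by (simp add: ac_simps)
  \<comment> \<open>The factorials telescope to a multinomial coefficient, so the division by their
    product is exact.\<close>
  also have "(p + q choose p) * (p + q + j choose j) = fact (p + q + j) div (fact p * fact q * fact j)"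
  proof -
    have 1: "fact p * fact q * (p + q choose p) = (fact (p + q) :: nat)"
      using binomial_fact_lemma[of p "p + q"] by simp
    have 2: "fact j * fact (p + q) * (p + q + j choose j) = (fact (p + q + j) :: nat)"
      using binomial_fact_lemma[of j "p + q + j"] by simp
    have "(p + q choose p) * (p + q + j choose j) * (fact p * fact q * fact j) = (fact (p + q + j) :: nat)"
      unfolding 2[symmetric] 1[symmetric] by (simp add: ac_simps)
    then show ?thesis by (metis fact_nonzero mult_eq_0_iff nonzero_mult_div_cancel_right)
  qed
  finally show ?thesis .
qed

lemma finite_skeletons: "finite (skeletons p q j)"
  by (rule finite_subset[OF _ finite_words[of "p + q + j"]])
    (auto simp: skeletons_def words_def length_conv_counts)

lemma card_closed_words_0: "card (closed_words 0 m) = (if m = 0 then 1 else 0)"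
proof -
  have "closed_words 0 m = (if m = 0 then {[]} else {})"
    by (auto simp: closed_words_def words_def Nil_in)
  then show ?thesis by simp
qed

lemma card_closed_words_Suc_0: "card (closed_words (Suc p) 0) = 0"
  by (auto simp: closed_words_def words_def card_eq_0_iff)

lemma card_closed_words_Suc_Suc: "card (closed_words (Suc p) (Suc m)) = card (open_words p m)"
proof -
  have "closed_words (Suc p) (Suc m) = (\<lambda>u. u @ [Down]) ` open_words p m"
  proof (intro equalityI subsetI)
    fix v assume v: "v \<in> closed_words (Suc p) (Suc m)"
    then obtain u where u: "v = u @ [Down]"
      using closed_tuple_ends_Down[of "Suc p" 0 v] by (auto simp: closed_words_def)
    then show "v \<in> (\<lambda>u. u @ [Down]) ` open_words p m"
      using v by (auto simp: closed_words_def open_words_def words_def closed_tuple_snoc level_snoc_Down)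
  qed (auto simp: closed_words_def open_words_def words_def closed_tuple_snoc level_snoc_Down
      alphabet_def)
  then show ?thesis by (simp add: card_image inj_on_def)
qed

text \<open>Splitting into \<open>ground 0 v\<close> and \<open>above 0 v\<close> is a bijection
  with inverse \<open>merge 0\<close>. The ground word determines \<open>q\<close> and
  \<open>j\<close>, which keeps the summands disjoint, and takes up \<open>p + q + j\<close> of the
  length.\<close>

lemma card_open_words:
  "card (open_words p m) =
     (\<Sum>(q, j) | p + q + j \<le> m. fact (p + q + j) div (fact p * fact q * fact j) * num j *
        card (closed_words q (m - (p + q + j))))"
proof -
  let ?I = "{(q, j). p + q + j \<le> m}"
  let ?S = "\<lambda>(q, j). skeletons p q j \<times> closed_words q (m - (p + q + j))"
  have fin: "finite ?I" by (rule finite_subset[of _ "{..m} \<times> {..m}"]) auto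
  have "bij_betw (\<lambda>v. (ground 0 v, above 0 v)) (open_words p m) (\<Union>x\<in>?I. ?S x)"
  proof (rule bij_betw_byWitness[where f' = "\<lambda>(u, v). merge 0 u v"])
    show "\<forall>v\<in>open_words p m. (case (ground 0 v, above 0 v) of (u, v) \<Rightarrow> merge 0 u v) = v"
      by (simp add: merge_ground_above)
    show "\<forall>x\<in>\<Union>x\<in>?I. ?S x.
      (ground 0 (case x of (u, v) \<Rightarrow> merge 0 u v), above 0 (case x of (u, v) \<Rightarrow> merge 0 u v)) = x"
      using tuple_merge[of _ 0] by (auto simp: skeletons_def closed_words_def)
    show "(\<lambda>v. (ground 0 v, above 0 v)) ` open_words p m \<subseteq> (\<Union>x\<in>?I. ?S x)"
    proof (rule image_subsetI)
      fix v assume v: "v \<in> open_words p m"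
      define q where "q = count_list (ground 0 v) Up"
      define j where "j = length (letters (ground 0 v))"
      have o: "open_tuple p 0 v" "length v = m" "set v \<subseteq> alphabet"
        using v by (auto simp: open_words_def words_def)
      have l: "level 0 v i \<in> L" for i using v by (auto simp: open_words_def)
      have p: "count_list (ground 0 v) Down = p" by (rule count_Down_ground[OF o(1)])
      have len: "length (ground 0 v) = p + q + j"
        by (simp add: length_conv_counts p q_def j_def)
      then have le: "p + q + j + length (above 0 v) = m"
        using length_ground_above[of 0 v] o(2) by simp
      have "ground 0 v \<in> skeletons p q j"
        using l[of 0] set_ground_above[of 0 v] o(3) p
        by (auto simp: skeletons_def q_def j_def level_0)
      moreover have "above 0 v \<in> closed_words q (m - (p + q + j))"
        using closed_tuple_above[OF o(1)] l[of "Suc _"] set_ground_above[of 0 v] o(3) le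
        by (auto simp: closed_words_def words_def q_def level_Suc)
      ultimately show "(ground 0 v, above 0 v) \<in> (\<Union>x\<in>?I. ?S x)"
        using le by (intro UN_I[of "(q, j)"]) auto
    qed
    show "(\<lambda>(u, v). merge 0 u v) ` (\<Union>x\<in>?I. ?S x) \<subseteq> open_words p m"
    proof (clarsimp)
      fix q j u v assume le: "p + q + j \<le> m" and u: "u \<in> skeletons p q j"
        and v: "v \<in> closed_words q (m - (p + q + j))"
      let ?w = "merge 0 u v"
      have w: "open_tuple p 0 ?w" "ground 0 ?w = u" "above 0 ?w = v"
        using tuple_merge[of u 0 v] u v by (auto simp: skeletons_def closed_words_def)
      have "length ?w = m"
        using length_ground_above[of 0 ?w] w u v le
        by (auto simp: skeletons_def closed_words_def words_def length_conv_counts)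
      moreover have "set ?w \<subseteq> alphabet"
        using set_ground_above[of 0 ?w] w u v
        by (auto simp: skeletons_def closed_words_def words_def)
      moreover have "level 0 ?w i \<in> L" for i
        using w u v by (cases i) (auto simp: level_0 level_Suc skeletons_def closed_words_def)
      ultimately show "?w \<in> open_words p m" using w by (auto simp: open_words_def words_def)
    qed
  qed
  then have "card (open_words p m) = card (\<Union>x\<in>?I. ?S x)" by (rule bij_betw_same_card)
  also have "\<dots> = (\<Sum>x\<in>?I. card (?S x))"
  proof (rule card_UN_disjoint)
    show "\<forall>x\<in>?I. finite (?S x)" by (auto simp: finite_skeletons finite_closed_words)
    show "\<forall>x\<in>?I. \<forall>y\<in>?I. x \<noteq> y \<longrightarrow> ?S x \<inter> ?S y = {}" by (auto simp: skeletons_def)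
  qed (fact fin)
  also have "\<dots> = (\<Sum>(q, j)\<in>?I. fact (p + q + j) div (fact p * fact q * fact j) * num j *
        card (closed_words q (m - (p + q + j))))"
    by (intro sum.cong) (auto simp: card_cartesian_product card_skeletons)
  finally show ?thesis .
qed

text \<open>Both halves share the index \<open>p\<close>, which the upper one determines and which
  is at most its length \<open>m\<close>; this bounds the range of \<open>p\<close>. The open tuple
  in the upper half is counted as a closed one with an additional separator.\<close>

lemma card_closed_paths:
  "card (closed_paths k) =
     (\<Sum>(p, m) \<in> {..k} \<times> {..k}. card (closed_words (Suc p) (Suc m)) * card (closed_words p (k - m)))"
proof -
  let ?I = "{..k} \<times> {..k}"
  let ?S = "\<lambda>(p, m). open_words p m \<times> closed_words p (k - m)"
  have "bij_betw (\<lambda>w. (upper 0 w, lower 0 w)) (closed_paths k) (\<Union>x\<in>?I. ?S x)"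
  proof (rule bij_betw_byWitness[where f' = "\<lambda>(u, v). zmerge 0 u v"])
    show "\<forall>w\<in>closed_paths k. (case (upper 0 w, lower 0 w) of (u, v) \<Rightarrow> zmerge 0 u v) = w"
      by (simp add: zmerge_upper_lower)
    show "\<forall>x\<in>\<Union>x\<in>?I. ?S x.
      (upper 0 (case x of (u, v) \<Rightarrow> zmerge 0 u v), lower 0 (case x of (u, v) \<Rightarrow> zmerge 0 u v)) = x"
      using tuples_zmerge[of 0] by (auto simp: open_words_def closed_words_def)
    have flip: "flip s \<in> alphabet \<longleftrightarrow> s \<in> alphabet" for s
      by (cases s) (auto simp: alphabet_def)
    show "(\<lambda>w. (upper 0 w, lower 0 w)) ` closed_paths k \<subseteq> (\<Union>x\<in>?I. ?S x)"
    proof (rule image_subsetI)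
      fix w assume w: "w \<in> closed_paths k"
      then obtain p where p: "open_tuple p 0 (upper 0 w)" "closed_tuple p 0 (lower 0 w)"
        using tuples_upper_lower[of 0 w] by (auto simp: closed_paths_def)
      define m where "m = length (upper 0 w)"
      have len: "m + length (lower 0 w) = k"
        using w length_upper_lower[of 0 w] by (simp add: m_def closed_paths_def words_def)
      have al: "set (upper 0 w) \<subseteq> alphabet" "set (lower 0 w) \<subseteq> alphabet"
        using w set_upper_lower[of w 0] by (auto simp: closed_paths_def words_def flip)
      have "zlevel 0 w i \<in> L" for i using w by (simp add: closed_paths_def)
      from this[of "int _"] this[of "- 1 - int _"]
      have "level 0 (upper 0 w) i \<in> L" "level 0 (lower 0 w) i \<in> L" for i
        by (simp_all add: zlevel_nonneg zlevel_neg)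
      then have "upper 0 w \<in> open_words p m" "lower 0 w \<in> closed_words p (k - m)"
        using p al len by (auto simp: open_words_def closed_words_def words_def m_def)
      moreover have "p \<le> m" using open_tuple_le[OF p(1)] by (simp add: m_def)
      ultimately show "(upper 0 w, lower 0 w) \<in> (\<Union>x\<in>?I. ?S x)"
        using len by (intro UN_I[of "(p, m)"]) auto
    qed
    show "(\<lambda>(u, v). zmerge 0 u v) ` (\<Union>x\<in>?I. ?S x) \<subseteq> closed_paths k"
    proof (clarsimp)
      fix p m u v assume le: "p \<le> k" "m \<le> k" and u: "u \<in> open_words p m"
        and v: "v \<in> closed_words p (k - m)"
      let ?w = "zmerge 0 u v"
      have w: "zend 0 ?w = 0" "upper 0 ?w = u" "lower 0 ?w = v"
        using tuples_zmerge[of 0 p u v] u v by (auto simp: open_words_def closed_words_def)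
      have "length ?w = k"
        using length_upper_lower[of 0 ?w] w u v le
        by (auto simp: open_words_def closed_words_def words_def)
      moreover have "set ?w \<subseteq> alphabet"
        using set_upper_lower[of ?w 0] w u v
        by (auto simp: open_words_def closed_words_def words_def flip)
      moreover have "zlevel 0 ?w i \<in> L" for i
      proof (cases "i \<ge> 0")
        case True
        then show ?thesis using zlevel_nonneg[of 0 ?w "nat i"] w u by (auto simp: open_words_def)
      next
        case False
        then show ?thesis using zlevel_neg[of 0 ?w "nat (- 1 - i)"] w v
          by (auto simp: closed_words_def)
      qed
      ultimately show "?w \<in> closed_paths k" using w by (auto simp: closed_paths_def words_def)
    qed
  qed
  then have "card (closed_paths k) = card (\<Union>x\<in>?I. ?S x)" by (rule bij_betw_same_card)
  also have "\<dots> = (\<Sum>x\<in>?I. card (?S x))"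
  proof (rule card_UN_disjoint)
    show "\<forall>x\<in>?I. finite (?S x)" by (auto simp: finite_open_words finite_closed_words)
    show "\<forall>x\<in>?I. \<forall>y\<in>?I. x \<noteq> y \<longrightarrow> ?S x \<inter> ?S y = {}"
      by (auto simp: open_words_def words_def dest: open_tuple_unique)
  qed simp
  also have "\<dots> = (\<Sum>(p, m)\<in>?I. card (closed_words (Suc p) (Suc m)) * card (closed_words p (k - m)))"
    by (intro sum.cong) (auto simp: card_cartesian_product card_closed_words_Suc_Suc)
  finally show ?thesis .
qed

end

section \<open>Wreath products with the integers\<close>

lemma mult_wreath_Z [simp]:
  "(x, h) \<otimes>\<^bsub>wreath_Z G\<^esub> (y, k) = ((\<lambda>i. x i \<otimes>\<^bsub>G\<^esub> y (i - h)), h + k)"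
  by (simp add: wreath_Z_def semidirect_product_def shift_def restrict_def)

lemma one_wreath_Z [simp]: "\<one>\<^bsub>wreath_Z G\<^esub> = ((\<lambda>_. \<one>\<^bsub>G\<^esub>), 0)"
  by (simp add: wreath_Z_def semidirect_product_def restrict_def)

lemma carrier_wreath_Z:
  assumes "group G"
  shows "carrier (wreath_Z G) = {x. range x \<subseteq> carrier G \<and> finite {i. x i \<noteq> \<one>\<^bsub>G\<^esub>}} \<times> UNIV"
  using assms by (auto simp: wreath_Z_def semidirect_product_def carrier_sum_group PiE_UNIV_domain)

lemma finite_shift_support: "finite {i::int. P i} \<Longrightarrow> finite {i. P (i - h)}"
  using finite_vimageI[of "{i. P i}" "\<lambda>i. i - h"] by (simp add: inj_def vimage_def)

lemma group_wreath_Z: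
  fixes G (structure)
  assumes "group G"
  shows "group (wreath_Z G)"
proof -
  interpret group G by fact
  have supp: "finite {i. x i \<otimes> y (i - h) \<noteq> \<one>}"
    if "finite {i. x i \<noteq> \<one>}" "finite {i. y i \<noteq> \<one>}" for x y and h :: int
    by (rule finite_subset[OF _ finite_UnI[OF that(1) finite_shift_support[OF that(2), of h]]]) auto
  show ?thesis
  proof (rule groupI)
    fix u v assume "u \<in> carrier (wreath_Z G)" "v \<in> carrier (wreath_Z G)"
    then show "u \<otimes>\<^bsub>wreath_Z G\<^esub> v \<in> carrier (wreath_Z G)"
      by (cases u; cases v) (auto simp: carrier_wreath_Z[OF assms] supp image_subset_iff)
  next
    fix u v w assume "u \<in> carrier (wreath_Z G)" "v \<in> carrier (wreath_Z G)" "w \<in> carrier (wreath_Z G)"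
    then show "u \<otimes>\<^bsub>wreath_Z G\<^esub> v \<otimes>\<^bsub>wreath_Z G\<^esub> w =
        u \<otimes>\<^bsub>wreath_Z G\<^esub> (v \<otimes>\<^bsub>wreath_Z G\<^esub> w)"
      by (cases u; cases v; cases w)
        (auto simp: carrier_wreath_Z[OF assms] image_subset_iff m_assoc diff_diff_eq)
  next
    fix u assume "u \<in> carrier (wreath_Z G)"
    then obtain x h where u: "u = (x, h)" "range x \<subseteq> carrier G" "finite {i. x i \<noteq> \<one>}"
      by (auto simp: carrier_wreath_Z[OF assms])
    have "{i. inv (x i) \<noteq> \<one>} = {i. x i \<noteq> \<one>}"
      using u(2) by (auto simp: image_subset_iff)
    then have "finite {i. inv (x i) \<noteq> \<one>}" using u(3) by simp
    \<comment> \<open>The inverse of \<open>(x, h)\<close> is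
      \<open>(\<lambda>i. inv (x (i + h)), - h)\<close>: its support is that of \<open>x\<close>,
      translated by \<open>- h\<close>.\<close>
    from finite_shift_support[OF this, of "- h"]
    have "((\<lambda>i. inv (x (i + h))), - h) \<in> carrier (wreath_Z G)"
      using u by (auto simp: carrier_wreath_Z[OF assms])
    moreover have "((\<lambda>i. inv (x (i + h))), - h) \<otimes>\<^bsub>wreath_Z G\<^esub> u = \<one>\<^bsub>wreath_Z G\<^esub>"
      using u by (auto simp: image_subset_iff)
    ultimately show "\<exists>y\<in>carrier (wreath_Z G). y \<otimes>\<^bsub>wreath_Z G\<^esub> u = \<one>\<^bsub>wreath_Z G\<^esub>" by blast
  next
    fix u assume "u \<in> carrier (wreath_Z G)"
    then show "\<one>\<^bsub>wreath_Z G\<^esub> \<otimes>\<^bsub>wreath_Z G\<^esub> u = u"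
      by (cases u) (auto simp: carrier_wreath_Z[OF assms] image_subset_iff)
  qed (auto simp: carrier_wreath_Z[OF assms])
qed

lemma wreath_top_closed: "group G \<Longrightarrow> wreath_top G z \<in> carrier (wreath_Z G)"
  by (auto simp: wreath_top_def carrier_wreath_Z group.is_monoid monoid.one_closed)

lemma wreath_base_closed:
  assumes "group G" "s \<in> carrier G"
  shows "wreath_base G s \<in> carrier (wreath_Z G)"
proof -
  have "finite {i. (if i = (0::int) then s else \<one>\<^bsub>G\<^esub>) \<noteq> \<one>\<^bsub>G\<^esub>}"
    by (rule finite_subset[of _ "{0}"]) auto
  then show ?thesis
    using assms by (auto simp: wreath_base_def carrier_wreath_Z group.is_monoid monoid.one_closed)
qed

lemma wreath_gens_closed:
  assumes "group G" "S \<subseteq> carrier G"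
  shows "wreath_gens G z S \<subseteq> carrier (wreath_Z G)"
  using assms by (auto simp: wreath_gens_def wreath_top_closed wreath_base_closed)

lemma inv_wreath_top:
  assumes "group G"
  shows "inv\<^bsub>wreath_Z G\<^esub> (wreath_top G z) = wreath_top G (- z)"
proof (rule group.inv_equality[OF group_wreath_Z[OF assms]])
  show "wreath_top G (- z) \<otimes>\<^bsub>wreath_Z G\<^esub> wreath_top G z = \<one>\<^bsub>wreath_Z G\<^esub>"
    using assms by (simp add: wreath_top_def group.is_monoid monoid.l_one monoid.one_closed)
qed (use assms in \<open>auto simp: wreath_top_closed\<close>)

lemma inv_wreath_base:
  fixes G (structure)
  assumes "group G" "s \<in> carrier G"
  shows "inv\<^bsub>wreath_Z G\<^esub> (wreath_base G s) = wreath_base G (inv\<^bsub>G\<^esub> s)"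
proof -
  interpret group G by fact
  show ?thesis
  proof (rule group.inv_equality[OF group_wreath_Z[OF assms(1)]])
    show "wreath_base G (inv s) \<otimes>\<^bsub>wreath_Z G\<^esub> wreath_base G s = \<one>\<^bsub>wreath_Z G\<^esub>"
      using assms by (auto simp: wreath_base_def)
  qed (use assms in \<open>auto simp: wreath_base_closed\<close>)
qed

section \<open>Loops of the wreath product as closed paths\<close>

definition symmetric_gens :: "('a, 'b) monoid_scheme \<Rightarrow> 'a set \<Rightarrow> 'a set" where
  "symmetric_gens H T = T \<union> m_inv H ` T"

definition identity_words :: "('a, 'b) monoid_scheme \<Rightarrow> 'a set \<Rightarrow> 'a list set" where
  "identity_words H T = (\<Union>k. loops H T k)"

lemma in_loops:
  "w \<in> loops H T k \<longleftrightarrow> length w = k \<and> set w \<subseteq> symmetric_gens H T \<and>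
    foldr (\<otimes>\<^bsub>H\<^esub>) w \<one>\<^bsub>H\<^esub> = \<one>\<^bsub>H\<^esub>"
  by (simp add: loops_def symmetric_gens_def)

lemma in_identity_words:
  "w \<in> identity_words H T \<longleftrightarrow> set w \<subseteq> symmetric_gens H T \<and>
    foldr (\<otimes>\<^bsub>H\<^esub>) w \<one>\<^bsub>H\<^esub> = \<one>\<^bsub>H\<^esub>"
  by (auto simp: identity_words_def in_loops)

lemma identity_words_length: "{l \<in> identity_words H T. length l = k} = loops H T k"
  by (auto simp: identity_words_def loops_def)

lemma language_identity_words:
  assumes "finite S"
  shows "language (symmetric_gens G S) (identity_words G S)"
  using assms by unfold_locales (auto simp: symmetric_gens_def identity_words_def loops_def)

fun step_elem :: "('a, 'b) monoid_scheme \<Rightarrow> 'a step \<Rightarrow> (int \<Rightarrow> 'a) \<times> int" where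
  "step_elem G Up = wreath_top G 1"
| "step_elem G Down = wreath_top G (- 1)"
| "step_elem G (Letter b) = wreath_base G b"

text \<open>Loops are words over a set of group elements, so different steps must not collapse. The
  integer component separates \<open>Up\<close>, \<open>Down\<close> and letters, even a letter
  equal to the identity; the value at index 0 separates letters.\<close>

lemma inj_step_elem: "inj (step_elem G)"
proof (rule injI)
  fix s t :: "'a step" assume "step_elem G s = step_elem G t"
  then show "s = t"
    by (cases s; cases t) (auto simp: wreath_top_def wreath_base_def fun_eq_iff split: if_splits)
qed

lemma zlevel_translate: "zlevel (h + d) w (i + d) = zlevel h w i"
proof (induction w arbitrary: h)
  case (Cons s w)
  show ?case using Cons[of "h + 1"] Cons[of "h - 1"] Cons[of h] by (cases s) (auto simp: algebra_simps)
qed simp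

lemma zend_translate: "zend (h + d) w = zend h w + d"
proof (induction w arbitrary: h)
  case (Cons s w)
  show ?case using Cons[of "h + 1"] Cons[of "h - 1"] Cons[of h] by (cases s) (auto simp: algebra_simps)
qed simp

lemma foldr_mult_closed:
  assumes "group G" "set l \<subseteq> carrier G"
  shows "foldr (\<otimes>\<^bsub>G\<^esub>) l \<one>\<^bsub>G\<^esub> \<in> carrier G"
  using assms by (induction l) (auto simp: group.is_monoid monoid.m_closed monoid.one_closed)

lemma set_zlevel: "b \<in> set (zlevel h w i) \<Longrightarrow> Letter b \<in> set w"
  by (induction h w i rule: zlevel.induct) (auto split: if_splits)

text \<open>Prepending a step that moves by \<open>d\<close> translates the base function of the
  remaining product by \<open>d\<close>, which is also what starting the remaining path at height
  \<open>d\<close> does to its levels.\<close>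

lemma foldr_wreath_Z:
  assumes "group G" "\<And>b. Letter b \<in> set w \<Longrightarrow> b \<in> carrier G"
  shows "foldr (\<otimes>\<^bsub>wreath_Z G\<^esub>) (map (step_elem G) w) \<one>\<^bsub>wreath_Z G\<^esub> =
    ((\<lambda>i. foldr (\<otimes>\<^bsub>G\<^esub>) (zlevel 0 w i) \<one>\<^bsub>G\<^esub>), zend 0 w)"
  using assms(2)
proof (induction w)
  case (Cons s w)
  interpret group G by fact
  have IH: "foldr (\<otimes>\<^bsub>wreath_Z G\<^esub>) (map (step_elem G) w) \<one>\<^bsub>wreath_Z G\<^esub> =
    ((\<lambda>i. foldr (\<otimes>\<^bsub>G\<^esub>) (zlevel 0 w i) \<one>\<^bsub>G\<^esub>), zend 0 w)"
    using Cons by simp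
  have c: "foldr (\<otimes>\<^bsub>G\<^esub>) (zlevel 0 w i) \<one>\<^bsub>G\<^esub> \<in> carrier G" for i
    by (rule foldr_mult_closed) (use set_zlevel[of _ 0 w i] Cons.prems in auto)
  have z: "zlevel 1 w i = zlevel 0 w (i - 1)" "zlevel (- 1) w i = zlevel 0 w (i + 1)"
    "zend 1 w = 1 + zend 0 w" "zend (- 1) w = zend 0 w - 1" for i
    using zlevel_translate[of 0 1 w "i - 1"] zlevel_translate[of 0 "- 1" w "i + 1"]
      zend_translate[of 0 1 w] zend_translate[of 0 "- 1" w] by simp_all
  show ?case
  proof (cases s)
    case Up
    then show ?thesis using IH c by (simp add: wreath_top_def z del: one_wreath_Z)
  next
    case Down
    then show ?thesis using IH c by (simp add: wreath_top_def z del: one_wreath_Z)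
  next
    case (Letter b)
    then show ?thesis using IH c by (auto simp: wreath_base_def fun_eq_iff simp del: one_wreath_Z)
  qed
qed simp

text \<open>The sign of \<open>z\<close> disappears once inverses are added, so \<open>Up\<close>
  and \<open>Down\<close> can be fixed as 1 and -1.\<close>

lemma symmetric_wreath_gens:
  assumes "group G" "S \<subseteq> carrier G" "z = 1 \<or> z = - 1"
  shows "symmetric_gens (wreath_Z G) (wreath_gens G z S) =
    step_elem G ` ({Up, Down} \<union> Letter ` symmetric_gens G S)"
proof -
  have "m_inv (wreath_Z G) ` wreath_base G ` S = wreath_base G ` m_inv G ` S"
    unfolding image_image by (rule image_cong) (use assms in \<open>auto simp: inv_wreath_base\<close>)
  then show ?thesis
    using assms(3)
    by (auto simp: symmetric_gens_def wreath_gens_def inv_wreath_top[OF assms(1)]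
        image_Un image_image)
qed

text \<open>A product is trivial iff the path ends at 0 and the letters at every height multiply to
  the identity. Injectivity of \<open>step_elem\<close> carries this over to cardinalities.\<close>

lemma num_loops_wreath_Z:
  assumes G: "group G" and S: "finite S" "S \<subseteq> carrier G" and z: "z = 1 \<or> z = - 1"
  shows "num_loops (wreath_Z G) (wreath_gens G z S) k =
    card (language.closed_paths (symmetric_gens G S) (identity_words G S) k)"
proof -
  interpret group G by fact
  interpret language "symmetric_gens G S" "identity_words G S"
    using S(1) by (rule language_identity_words)
  have carr: "symmetric_gens G S \<subseteq> carrier G" using S by (auto simp: symmetric_gens_def)
  have fst: "w \<in> closed_paths k \<longleftrightarrow> map (step_elem G) w \<in> loops (wreath_Z G) (wreath_gens G z S) k"
    if w: "set w \<subseteq> alphabet" for w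
  proof -
    have b: "b \<in> symmetric_gens G S" if "Letter b \<in> set w" for b
      using w that by (auto simp: alphabet_def)
    have "set (map (step_elem G) w) \<subseteq> symmetric_gens (wreath_Z G) (wreath_gens G z S)"
      using image_mono[OF w, of "step_elem G"]
      unfolding symmetric_wreath_gens[OF G S(2) z] alphabet_def set_map .
    moreover have "foldr (\<otimes>\<^bsub>wreath_Z G\<^esub>) (map (step_elem G) w) \<one>\<^bsub>wreath_Z G\<^esub> =
      ((\<lambda>i. foldr (\<otimes>\<^bsub>G\<^esub>) (zlevel 0 w i) \<one>\<^bsub>G\<^esub>), zend 0 w)"
      by (rule foldr_wreath_Z[OF G]) (use b carr in auto)
    moreover have "set (zlevel 0 w i) \<subseteq> symmetric_gens G S" for i
      using set_zlevel b by fast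
    ultimately show ?thesis
      using w by (simp add: closed_paths_def words_def in_identity_words in_loops fun_eq_iff conj_ac)
  qed
  have "loops (wreath_Z G) (wreath_gens G z S) k = map (step_elem G) ` closed_paths k"
  proof (intro equalityI subsetI)
    fix u assume u: "u \<in> loops (wreath_Z G) (wreath_gens G z S) k"
    then have "set u \<subseteq> step_elem G ` alphabet"
      unfolding alphabet_def symmetric_wreath_gens[OF G S(2) z, symmetric]
      by (simp add: loops_def symmetric_gens_def)
    then have "u \<in> lists (step_elem G ` alphabet)" by blast
    then obtain w where "u = map (step_elem G) w" "set w \<subseteq> alphabet"
      unfolding lists_image by blast
    then show "u \<in> map (step_elem G) ` closed_paths k" using fst u by auto
  next
    fix u assume "u \<in> map (step_elem G) ` closed_paths k"
    then show "u \<in> loops (wreath_Z G) (wreath_gens G z S) k"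
      using fst by (auto simp: closed_paths_def words_def)
  qed
  then show ?thesis
    unfolding num_loops_def
    by (simp add: card_image inj_on_subset[OF inj_mapI[OF inj_step_elem]])
qed

text \<open>With an empty base generating set only the two top generators remain, and base functions
  into \<open>unit\<close> are all equal, so \<open>snd\<close> is injective on words.\<close>

lemma num_loops_integer_group:
  "num_loops integer_group {1} k =
    num_loops (wreath_Z (singleton_group ())) (wreath_gens (singleton_group ()) 1 {}) k"
proof -
  let ?G = "singleton_group ()"
  have fold: "foldr (\<otimes>\<^bsub>wreath_Z ?G\<^esub>) w \<one>\<^bsub>wreath_Z ?G\<^esub> =
      ((\<lambda>_. ()), foldr (\<otimes>\<^bsub>integer_group\<^esub>) (map snd w) \<one>\<^bsub>integer_group\<^esub>)" for w
    by (induction w) (auto simp: fun_eq_iff)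
  have fold_one: "foldr (\<otimes>\<^bsub>wreath_Z ?G\<^esub>) w \<one>\<^bsub>wreath_Z ?G\<^esub> = \<one>\<^bsub>wreath_Z ?G\<^esub> \<longleftrightarrow>
      foldr (\<otimes>\<^bsub>integer_group\<^esub>) (map snd w) 0 = 0" for w
    unfolding fold by (simp add: fun_eq_iff)
  have "loops integer_group {1} k = map snd ` loops (wreath_Z ?G) (wreath_gens ?G 1 {}) k"
  proof (intro equalityI subsetI)
    fix w assume w: "w \<in> loops integer_group {1} k"
    let ?u = "map (wreath_top ?G) w"
    have s: "snd \<circ> wreath_top ?G = id" by (auto simp: wreath_top_def)
    then have "map snd ?u = w" by simp
    moreover have "?u \<in> loops (wreath_Z ?G) (wreath_gens ?G 1 {}) k"
      using w by (auto simp: loops_def wreath_gens_def inv_wreath_top fold_one s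
          simp del: one_wreath_Z)
    ultimately show "w \<in> map snd ` loops (wreath_Z ?G) (wreath_gens ?G 1 {}) k"
      by (metis imageI)
  next
    fix w assume "w \<in> map snd ` loops (wreath_Z ?G) (wreath_gens ?G 1 {}) k"
    then show "w \<in> loops integer_group {1} k"
      by (auto simp: loops_def wreath_gens_def inv_wreath_top fold_one simp del: one_wreath_Z)
        (auto simp: wreath_top_def)
  qed
  moreover have "inj (map (snd :: (int \<Rightarrow> unit) \<times> int \<Rightarrow> int))"
    by (rule inj_mapI) (auto simp: inj_def fun_eq_iff)
  ultimately show ?thesis
    unfolding num_loops_def by (metis card_image inj_on_subset subset_UNIV)
qed

section \<open>Running times of programs\<close>

lemma bits_less: "x < 2 ^ bits x"
  using floorlog_bounds[of x 2] by (cases "x = 0") auto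

lemma bits_le: "x < 2 ^ k \<Longrightarrow> bits x \<le> k"
  by (rule floorlog_leI) auto

lemma bits_add: "bits (x + y) \<le> bits x + bits y + 1"
proof (rule bits_le)
  have "x < 2 ^ (bits x + bits y)" "y < 2 ^ (bits x + bits y)"
    using bits_less[of x] bits_less[of y]
    by (auto elim!: less_le_trans intro!: power_increasing)
  then show "x + y < 2 ^ (bits x + bits y + 1)" by simp
qed

lemma bits_mult: "bits (x * y) \<le> bits x + bits y"
  by (rule bits_le) (simp add: power_add mult_strict_mono bits_less)

text \<open>Bounds the digits of a value in units \<open>bits V + 1\<close>: loaded cells are at
  most \<open>V\<close>, truncated subtraction and division do not exceed their left operand, and an
  addition may carry.\<close>

fun expr_size :: "expr \<Rightarrow> nat" where
  "expr_size (Const c) = bits c"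
| "expr_size (Load e) = 1"
| "expr_size (Add e e') = expr_size e + expr_size e' + 1"
| "expr_size (Sub e e') = expr_size e"
| "expr_size (Mul e e') = expr_size e + expr_size e'"
| "expr_size (Div e e') = expr_size e"

fun expr_steps :: "expr \<Rightarrow> nat" where
  "expr_steps (Const c) = 1 + bits c"
| "expr_steps (Load e) = expr_steps e + expr_size e + 2"
| "expr_steps (Add e e') = expr_steps e + expr_steps e' + 1 + expr_size e + expr_size e'"
| "expr_steps (Sub e e') = expr_steps e + expr_steps e' + 1 + expr_size e + expr_size e'"
| "expr_steps (Mul e e') = expr_steps e + expr_steps e' + 1 + expr_size e + expr_size e'"
| "expr_steps (Div e e') = expr_steps e + expr_steps e' + 1 + expr_size e + expr_size e'"

definition bounded :: "nat \<Rightarrow> mem \<Rightarrow> bool" where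
  "bounded V m \<longleftrightarrow> (\<forall>i. m i \<le> V)"

lemma bits_val_le:
  assumes "bounded V m"
  shows "bits (val e m) \<le> expr_size e * (bits V + 1)"
proof (induction e)
  case (Load e)
  show ?case using assms by (auto simp: bounded_def intro: le_SucI floorlog_mono)
next
  case (Add e e')
  then show ?case using bits_add[of "val e m" "val e' m"] by (simp add: algebra_simps)
next
  case (Sub e e')
  have "bits (val e m - val e' m) \<le> bits (val e m)" by (intro floorlog_mono) simp
  then show ?case using Sub by simp
next
  case (Mul e e')
  then show ?case using bits_mult[of "val e m" "val e' m"] by (simp add: algebra_simps)
next
  case (Div e e')
  have "bits (val e m div val e' m) \<le> bits (val e m)" by (intro floorlog_mono) simp
  then show ?case using Div by simp
qed simp

lemma cost_le:
  assumes "bounded V m"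
  shows "cost e m \<le> expr_steps e * (bits V + 1)"
proof (induction e)
  case (Load e)
  have "bits (m (val e m)) \<le> bits V" using assms by (auto simp: bounded_def intro: floorlog_mono)
  then show ?case using Load bits_val_le[OF assms, of e] by (simp add: algebra_simps)
next
  case (Add e e')
  then show ?case using bits_val_le[OF assms, of e] bits_val_le[OF assms, of e']
    by (simp add: algebra_simps)
next
  case (Sub e e')
  then show ?case using bits_val_le[OF assms, of e] bits_val_le[OF assms, of e']
    by (simp add: algebra_simps)
next
  case (Mul e e')
  then show ?case using bits_val_le[OF assms, of e] bits_val_le[OF assms, of e']
    by (simp add: algebra_simps)
next
  case (Div e e')
  then show ?case using bits_val_le[OF assms, of e] bits_val_le[OF assms, of e']
    by (simp add: algebra_simps)
qed simp

text \<open>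
  If all cells are bounded by \<open>V\<close>, then evaluating a fixed expression costs at most a constant
  number of units \<open>bits V + 1\<close>, so that running times can be counted in these units.
\<close>

definition correct :: "nat \<Rightarrow> (mem \<Rightarrow> bool) \<Rightarrow> prog \<Rightarrow> nat \<Rightarrow> (mem \<Rightarrow> bool) \<Rightarrow> bool" where
  "correct V P prg T Q \<longleftrightarrow> (\<forall>m. P m \<and> bounded V m \<longrightarrow>
     (\<exists>t m'. exec prg m t m' \<and> t \<le> T * (bits V + 1) \<and> Q m' \<and> bounded V m'))"

definition store_steps :: "expr \<Rightarrow> expr \<Rightarrow> nat" where
  "store_steps a e = expr_steps a + expr_steps e + expr_size a + expr_size e + 1"

lemma correct_Store:
  assumes "\<And>m. P m \<Longrightarrow> bounded V m \<Longrightarrow> val e m \<le> V \<and> Q (m(val a m := val e m))"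
  shows "correct V P (Store a e) (store_steps a e) Q"
  unfolding correct_def
proof (intro allI impI, elim conjE)
  fix m assume m: "P m" "bounded V m"
  let ?t = "cost a m + cost e m + 1 + bits (val a m) + bits (val e m)"
  have "?t \<le> store_steps a e * (bits V + 1)"
    unfolding store_steps_def using cost_le[OF m(2), of a] cost_le[OF m(2), of e]
      bits_val_le[OF m(2), of a] bits_val_le[OF m(2), of e]
    by (simp add: algebra_simps)
  moreover have "bounded V (m(val a m := val e m))"
    using assms[OF m] m(2) by (simp add: bounded_def)
  ultimately show "\<exists>t m'. exec (Store a e) m t m' \<and>
      t \<le> store_steps a e * (bits V + 1) \<and>
      Q m' \<and> bounded V m'"
    using exec.Store[of a e m] assms[OF m] by blast
qed

lemma correct_Seq:
  assumes "correct V P prg T Q" "correct V Q prg' T' R"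
  shows "correct V P (Seq prg prg') (T + T') R"
  unfolding correct_def
proof (intro allI impI)
  fix m assume "P m \<and> bounded V m"
  then obtain t m' where 1: "exec prg m t m'" "t \<le> T * (bits V + 1)" "Q m'" "bounded V m'"
    using assms(1) unfolding correct_def by blast
  then obtain t' m'' where 2: "exec prg' m' t' m''" "t' \<le> T' * (bits V + 1)" "R m''" "bounded V m''"
    using assms(2) unfolding correct_def by blast
  have "t + t' \<le> (T + T') * (bits V + 1)" using 1(2) 2(2) by (simp add: algebra_simps)
  then show "\<exists>t m'. exec (Seq prg prg') m t m' \<and> t \<le> (T + T') * (bits V + 1) \<and> R m' \<and> bounded V m'"
    using exec.Seq[OF 1(1) 2(1)] 2 by blast
qed

lemma correct_When:
  assumes "correct V (\<lambda>m. P m \<and> val b m \<noteq> 0) prg T Q"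
    and "\<And>m. P m \<Longrightarrow> val b m = 0 \<Longrightarrow> Q m"
  shows "correct V P (Cond b prg Skip) (expr_steps b + expr_size b + 2 + T) Q"
  unfolding correct_def
proof (intro allI impI, elim conjE)
  fix m assume m: "P m" "bounded V m"
  have c: "cost b m \<le> expr_steps b * (bits V + 1)" "bits (val b m) \<le> expr_size b * (bits V + 1)"
    using cost_le[OF m(2)] bits_val_le[OF m(2)] by auto
  show "\<exists>t m'. exec (Cond b prg Skip) m t m' \<and>
    t \<le> (expr_steps b + expr_size b + 2 + T) * (bits V + 1) \<and> Q m' \<and> bounded V m'"
  proof (cases "val b m = 0")
    case True
    have "cost b m + 1 + 1 \<le> (expr_steps b + expr_size b + 2 + T) * (bits V + 1)"
      using c by (simp add: algebra_simps)
    then show ?thesis using exec.CondF[OF True exec.Skip] assms(2)[OF m(1) True] m(2) by blast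
  next
    case False
    then obtain t m' where 1: "exec prg m t m'" "t \<le> T * (bits V + 1)" "Q m'" "bounded V m'"
      using assms(1) m unfolding correct_def by blast
    have "cost b m + 1 + bits (val b m) + t \<le> (expr_steps b + expr_size b + 2 + T) * (bits V + 1)"
      using c 1 by (simp add: algebra_simps)
    then show ?thesis using exec.CondT[OF False 1(1)] 1 by blast
  qed
qed

text \<open>The number of rounds is known in advance: the invariant carries the round index, and the
  test fails exactly at \<open>X\<close>. The extra round in \<open>Suc X\<close> pays for the
  failing test.\<close>

lemma correct_While:
  assumes body: "\<And>x. x < X \<Longrightarrow> correct V (I x) prg T (I (Suc x))"
    and test: "\<And>x m. x \<le> X \<Longrightarrow> I x m \<Longrightarrow> val b m = 0 \<longleftrightarrow> x = X"
  shows "correct V (I 0) (While b prg) (Suc X * (T + expr_steps b + expr_size b + 1)) (I X)"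
proof -
  let ?K = "T + expr_steps b + expr_size b + 1"
  have "\<exists>t m'. exec (While b prg) m t m' \<and> t \<le> (Suc d * ?K) * (bits V + 1) \<and> I X m' \<and> bounded V m'"
    if "x + d = X" "I x m" "bounded V m" for x d m
    using that
  proof (induction d arbitrary: x m)
    case 0
    then have "cost b m + 1 \<le> (Suc 0 * ?K) * (bits V + 1)"
      using cost_le[of V m b] by (simp add: algebra_simps)
    moreover have "val b m = 0" using 0 test[of x m] by simp
    ultimately show ?case using exec.WhileF[of b m] 0 by force
  next
    case (Suc d)
    then have nz: "val b m \<noteq> 0" using test[of x m] by simp
    obtain t m' where 1: "exec prg m t m'" "t \<le> T * (bits V + 1)" "I (Suc x) m'" "bounded V m'"
      using body[of x] Suc.prems unfolding correct_def by auto
    obtain t' m'' where 2: "exec (While b prg) m' t' m''" "t' \<le> (Suc d * ?K) * (bits V + 1)"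
      "I X m''" "bounded V m''"
      using Suc.IH[of "Suc x" m'] Suc.prems 1 by auto
    have "cost b m + 1 + bits (val b m) + t \<le> ?K * (bits V + 1)"
      using 1(2) cost_le[OF Suc.prems(3), of b] bits_val_le[OF Suc.prems(3), of b]
      by (simp add: algebra_simps)
    then have "cost b m + 1 + bits (val b m) + t + t' \<le> (Suc (Suc d) * ?K) * (bits V + 1)"
      using 2(2) by (simp add: algebra_simps)
    then show ?case using exec.WhileT[OF nz 1(1) 2(1)] 2 by blast
  qed
  then show ?thesis unfolding correct_def by fastforce
qed

lemma correct_mono:
  assumes "correct V P prg T Q" "\<And>m. P' m \<Longrightarrow> P m" "T \<le> T'" "\<And>m. Q m \<Longrightarrow> Q' m"
  shows "correct V P' prg T' Q'"
  unfolding correct_def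
proof (intro allI impI)
  fix m assume "P' m \<and> bounded V m"
  then obtain t m' where 1: "exec prg m t m'" "t \<le> T * (bits V + 1)" "Q m'" "bounded V m'"
    using assms(1,2) unfolding correct_def by blast
  moreover have "T * (bits V + 1) \<le> T' * (bits V + 1)" using assms(3) by (rule mult_le_mono1)
  ultimately show "\<exists>t m'. exec prg m t m' \<and> t \<le> T' * (bits V + 1) \<and> Q' m' \<and> bounded V m'"
    using assms(4) by (meson order_trans)
qed

section \<open>The program\<close>

text \<open>
  With \<open>n\<close> in cell 0, the memory is used as a matrix with \<open>n + 3\<close> columns. Row 0 holds \<open>n\<close>, the
  numbers \<open>a\<^sub>0, \<dots>, a\<^sub>n\<close> and the loop counter; row 1 holds factorials, row 2 the numbers
  \<open>f\<^sub>0, \<dots>, f\<^sub>n\<close>, and entry \<open>p\<close> of row \<open>m + 3\<close> the number of closed \<open>p\<close>-tuples of length \<open>m\<close>.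
  Nested loops are run as a single loop whose counter is decoded in base \<open>n + 1\<close>.
\<close>

abbreviation size_e :: expr where "size_e \<equiv> Load (Const 0)"
abbreviation base_e :: expr where "base_e \<equiv> Add size_e (Const 1)"
abbreviation width_e :: expr where "width_e \<equiv> Add size_e (Const 3)"
abbreviation counter_addr :: expr where "counter_addr \<equiv> Add size_e (Const 2)"
abbreviation counter :: expr where "counter \<equiv> Load counter_addr"

definition cell :: "expr \<Rightarrow> expr \<Rightarrow> expr" where
  "cell r c = Add (Mul r width_e) c"

definition mod_e :: "expr \<Rightarrow> expr \<Rightarrow> expr" where
  "mod_e e e' = Sub e (Mul e' (Div e e'))"

definition leq_e :: "expr \<Rightarrow> expr \<Rightarrow> expr" where
  "leq_e e e' = Sub (Add e' (Const 1)) e"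

definition digit_e :: "nat \<Rightarrow> expr" where
  "digit_e k = mod_e (((\<lambda>e. Div e base_e) ^^ k) counter) base_e"

definition for_prog :: "expr \<Rightarrow> prog \<Rightarrow> prog" where
  "for_prog e body = Seq (Store counter_addr (Const 0))
     (While (Sub e counter) (Seq body (Store counter_addr (Add counter (Const 1)))))"

lemma val_cell [simp]: "val (cell r c) m = val r m * (m 0 + 3) + val c m"
  by (simp add: cell_def)

lemma val_mod_e [simp]: "val (mod_e e e') m = val e m mod val e' m"
  by (simp add: mod_e_def minus_mult_div_eq_mod)

lemma val_leq_e [simp]: "val (leq_e e e') m = 0 \<longleftrightarrow> \<not> val e m \<le> val e' m"
  by (auto simp: leq_e_def)

lemma val_digit_e: "val (digit_e k) m = m (m 0 + 2) div (m 0 + 1) ^ k mod (m 0 + 1)"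
proof -
  have "val (((\<lambda>e. Div e base_e) ^^ k) counter) m = m (m 0 + 2) div (m 0 + 1) ^ k"
  proof (induction k)
    case (Suc k)
    have "x div b ^ k div b = x div b ^ Suc k" for x b :: nat
      by (simp only: power_Suc2 div_mult2_eq)
    then show ?case using Suc by simp
  qed simp
  then show ?thesis by (simp add: digit_e_def)
qed

section \<open>Counting loops and guarded summation\<close>

definition for_steps :: "expr \<Rightarrow> nat \<Rightarrow> nat" where
  "for_steps e T = store_steps counter_addr (Const 0) +
     (T + store_steps counter_addr (Add counter (Const 1)) +
     expr_steps (Sub e counter) + expr_size (Sub e counter) + 1)"

text \<open>The counter is stored in memory too, hence the invariant must be insensitive to cell
  \<open>n + 2\<close>, and \<open>X \<le> V\<close> keeps the counter within the cell
  bound.\<close>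

lemma correct_for:
  assumes body: "\<And>x. x < X \<Longrightarrow>
      correct V (\<lambda>m. m 0 = n \<and> m (n + 2) = x \<and> I x m) body T
        (\<lambda>m. m 0 = n \<and> m (n + 2) = x \<and> I (Suc x) m)"
    and bound: "\<And>x m. x \<le> X \<Longrightarrow> m 0 = n \<Longrightarrow> I x m \<Longrightarrow> val e m = X"
    and frame: "\<And>x y m. x \<le> X \<Longrightarrow> I x (m(n + 2 := y)) \<longleftrightarrow> I x m"
    and X: "X \<le> V"
  shows "correct V (\<lambda>m. m 0 = n \<and> I 0 m) (for_prog e body) (Suc X * for_steps e T)
    (\<lambda>m. m 0 = n \<and> I X m)"
proof -
  let ?J = "\<lambda>x m. m 0 = n \<and> m (n + 2) = x \<and> I x m"
  let ?b = "Sub e counter"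
  have store: "correct V (\<lambda>m. m 0 = n \<and> I 0 m) (Store counter_addr (Const 0))
      (store_steps counter_addr (Const 0))
      (?J 0)"
    by (rule correct_Store) (auto simp: frame[simplified])
  have incr: "correct V (\<lambda>m. m 0 = n \<and> m (n + 2) = x \<and> I (Suc x) m)
      (Store counter_addr (Add counter (Const 1)))
      (store_steps counter_addr (Add counter (Const 1))) (?J (Suc x))" if "x < X" for x
    by (rule correct_Store) (use that X frame in auto)
  note loop = correct_While[where I = ?J and b = ?b, OF correct_Seq[OF body incr]]
  have "correct V (?J 0) (While ?b (Seq body (Store counter_addr (Add counter (Const 1)))))
      (Suc X * (T + store_steps counter_addr (Add counter (Const 1)) +
        expr_steps ?b + expr_size ?b + 1)) (?J X)"
    by (rule loop) (use bound in auto)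
  from correct_Seq[OF store this] show ?thesis
    unfolding for_prog_def
    by (rule correct_mono) (auto simp: for_steps_def algebra_simps)
qed

text \<open>Adds one summand to a cell; the guard discards those digit tuples that lie outside the
  index set of the sum.\<close>

definition accumulate :: "expr \<Rightarrow> expr \<Rightarrow> expr \<Rightarrow> prog" where
  "accumulate b a e = Cond b (Store a (Add (Load a) e)) Skip"

definition accumulate_steps :: "expr \<Rightarrow> expr \<Rightarrow> expr \<Rightarrow> nat" where
  "accumulate_steps b a e = expr_steps b + expr_size b + 2 + store_steps a (Add (Load a) e)"

lemma correct_accumulate:
  assumes "\<And>m. P m \<Longrightarrow> bounded V m \<Longrightarrow> val b m \<noteq> 0 \<Longrightarrow>
      m (val a m) + val e m \<le> V \<and> Q (m(val a m := m (val a m) + val e m))"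
    and "\<And>m. P m \<Longrightarrow> val b m = 0 \<Longrightarrow> Q m"
  shows "correct V P (accumulate b a e) (accumulate_steps b a e) Q"
  unfolding accumulate_def accumulate_steps_def
  by (rule correct_When[OF correct_Store]) (use assms in auto)

text \<open>Clearing starts at row 2. The results and the table together occupy rows 2 to
  \<open>n + 4\<close>, that is \<open>n + 3\<close> rows of \<open>n + 3\<close> cells.\<close>

abbreviation clear_addr :: expr where "clear_addr \<equiv> Add (Mul (Const 2) width_e) counter"

abbreviation fact_e :: "expr \<Rightarrow> expr" where "fact_e i \<equiv> Load (cell (Const 1) i)"

abbreviation table_e :: "expr \<Rightarrow> expr \<Rightarrow> expr" where
  "table_e m p \<equiv> Load (cell (Add m (Const 3)) p)"

text \<open>In the table loop, digits 3, 2, 1, 0 of the counter are the variables \<open>m\<close>,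
  \<open>p\<close>, \<open>q\<close>, \<open>j\<close> of the recursion for
  \<open>E (Suc p) (Suc m)\<close>.\<close>

definition sum_e :: expr where
  "sum_e = Add (Add (digit_e 2) (digit_e 1)) (digit_e 0)"

definition table_addr :: expr where
  "table_addr = cell (Add (digit_e 3) (Const 4)) (Add (digit_e 2) (Const 1))"

definition table_term :: expr where
  "table_term =
     Mul (Mul (Div (fact_e sum_e) (Mul (Mul (fact_e (digit_e 2)) (fact_e (digit_e 1))) (fact_e (digit_e 0))))
            (Load (Add (digit_e 0) (Const 1))))
       (table_e (Sub (digit_e 3) sum_e) (digit_e 1))"

text \<open>In the result loop, digits 2, 1, 0 of the counter are \<open>k\<close>,
  \<open>p\<close>, \<open>m\<close> of the formula for \<open>f k\<close>. The product acts as a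
  conjunction.\<close>

definition result_test :: expr where
  "result_test = Mul (leq_e (digit_e 0) (digit_e 2)) (leq_e (digit_e 1) (digit_e 2))"

definition result_addr :: expr where
  "result_addr = cell (Const 2) (digit_e 2)"

definition result_term :: expr where
  "result_term = Mul (table_e (Add (digit_e 0) (Const 1)) (Add (digit_e 1) (Const 1)))
     (table_e (Sub (digit_e 2) (digit_e 0)) (digit_e 1))"

definition base3_e :: expr where "base3_e = Mul (Mul base_e base_e) base_e"
definition base4_e :: expr where "base4_e = Mul base3_e base_e"

text \<open>The accumulators are cleared because the program is also run on memory left by an
  earlier run. It keeps \<open>n\<close> in cell 0 and leaves its results in the cells of the input,
  so that runs can be chained for iterated wreath products.\<close>

definition wreath_prog :: prog where
  "wreath_prog =
    Seq (for_prog (Mul width_e width_e) (Store clear_addr (Const 0)))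
    (Seq (Store (cell (Const 3) (Const 0)) (Const 1))
    (Seq (Store (cell (Const 1) (Const 0)) (Const 1))
    (Seq (for_prog size_e (Store (cell (Const 1) (Add counter (Const 1)))
            (Mul (fact_e counter) (Add counter (Const 1)))))
    (Seq (for_prog base4_e (accumulate (leq_e sum_e (digit_e 3)) table_addr table_term))
    (Seq (for_prog base3_e (accumulate result_test result_addr result_term))
      (for_prog base_e (Store (Add counter (Const 1)) (Load (cell (Const 2) counter)))))))))"

text \<open>Each loop makes at most \<open>(n + 3) ^ 4\<close> rounds; the factor 2 absorbs the
  additional failing test.\<close>

definition step_factor :: nat where
  "step_factor =
     2 * (for_steps (Mul width_e width_e) (store_steps clear_addr (Const 0))
      + store_steps (cell (Const 3) (Const 0)) (Const 1)
      + store_steps (cell (Const 1) (Const 0)) (Const 1)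
      + for_steps size_e (store_steps (cell (Const 1) (Add counter (Const 1)))
          (Mul (fact_e counter) (Add counter (Const 1))))
      + for_steps base4_e (accumulate_steps (leq_e sum_e (digit_e 3)) table_addr table_term)
      + for_steps base3_e (accumulate_steps result_test result_addr result_term)
      + for_steps base_e (store_steps (Add counter (Const 1)) (Load (cell (Const 2) counter))))"

text \<open>Separates the program from the groups: \<open>E\<close> and \<open>f\<close> are any
  numbers that obey the recursions. \<open>V\<close> bounds what is stored; intermediate values
  inside an expression may be larger and are accounted for by \<open>expr_size\<close>.\<close>

locale tables =
  fixes n V :: nat and a f :: "nat \<Rightarrow> nat" and E :: "nat \<Rightarrow> nat \<Rightarrow> nat"
  assumes E_0: "E 0 m = (if m = 0 then 1 else 0)"
    and E_Suc_0: "E (Suc p) 0 = 0"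
    and E_Suc_Suc: "E (Suc p) (Suc m) =
      (\<Sum>(q, j) | p + q + j \<le> m.
        fact (p + q + j) div (fact p * fact q * fact j) * a j * E q (m - (p + q + j)))"
    and f_eq: "f k = (\<Sum>(p, m) \<in> {..k} \<times> {..k}. E (Suc p) (Suc m) * E p (k - m))"
    and E_le: "m \<le> Suc n \<Longrightarrow> E p m \<le> V"
    and f_le: "k \<le> n \<Longrightarrow> f k \<le> V"
    and fact_le: "i \<le> n \<Longrightarrow> fact i \<le> V"
    and size_le: "(n + 3) ^ 4 \<le> V"
begin

section \<open>Counter digits and partial sums\<close>

definition w :: nat where "w = n + 3"
definition N :: nat where "N = n + 1"

lemma n_less: "n < N" "n < w" "n + 2 < w" "N < w" "N > 0" "w > 0"
  by (auto simp: w_def N_def)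

lemma pow_le: "w * w \<le> w ^ 4" "N ^ 4 \<le> w ^ 4" "N ^ 3 \<le> w ^ 4" "w \<le> w ^ 4" "1 \<le> w ^ 4"
proof -
  show "w \<le> w ^ 4" by (rule self_le_power) (auto simp: w_def)
  show "1 \<le> w ^ 4" by (rule one_le_power) (auto simp: w_def)
  show "N ^ 4 \<le> w ^ 4" by (rule power_mono) (auto simp: w_def N_def)
  have "w ^ 2 \<le> w ^ 4" by (rule power_increasing) (auto simp: w_def)
  then show "w * w \<le> w ^ 4" by (simp add: power2_eq_square)
  have "N ^ 3 \<le> w ^ 3" by (rule power_mono) (auto simp: w_def N_def)
  also have "\<dots> \<le> w ^ 4" by (rule power_increasing) (auto simp: w_def)
  finally show "N ^ 3 \<le> w ^ 4" .
qed

lemma w4_le: "w ^ 4 \<le> V"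
  using size_le by (simp add: w_def)

lemma cell_eq_iff: "c < w \<Longrightarrow> c' < w \<Longrightarrow> r * w + c = r' * w + c' \<longleftrightarrow> r = r' \<and> c = c'"
  using n_less(6) by (metis add.commute div_mult_self1 div_less add_0 less_irrefl mult.commute
      add_right_cancel neq0_conv)

definition digit :: "nat \<Rightarrow> nat \<Rightarrow> nat" where
  "digit x k = x div N ^ k mod N"

lemma digit_le: "digit x k \<le> n"
  unfolding digit_def using mod_less_divisor[of N "x div N ^ k"] by (simp add: N_def del: mod_less_divisor)

lemma expand4: "x < N ^ 4 \<Longrightarrow> x = ((digit x 3 * N + digit x 2) * N + digit x 1) * N + digit x 0"
proof -
  assume "x < N ^ 4"
  then have x: "x < N * N ^ 3" by (simp add: numeral_eq_Suc)
  have d: "x div N ^ Suc k = x div N ^ k div N" for k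
    by (metis div_mult2_eq power_Suc2)
  have e: "x div N ^ k = x div N ^ Suc k * N + digit x k" for k
    unfolding d digit_def by simp
  have "digit x 3 = x div N ^ 3"
    unfolding digit_def using x by (simp add: less_mult_imp_div_less)
  then show ?thesis
    using e[of 0] e[of 1] e[of 2] by (simp add: numeral_eq_Suc)
qed

lemma expand3: "x < N ^ 3 \<Longrightarrow> x = (digit x 2 * N + digit x 1) * N + digit x 0"
proof -
  assume "x < N ^ 3"
  then have x: "x < N * N ^ 2" by (simp add: numeral_eq_Suc)
  have d: "x div N ^ Suc k = x div N ^ k div N" for k
    by (metis div_mult2_eq power_Suc2)
  have e: "x div N ^ k = x div N ^ Suc k * N + digit x k" for k
    unfolding d digit_def by simp
  have "digit x 2 = x div N ^ 2"
    unfolding digit_def using x by (simp add: less_mult_imp_div_less)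
  then show ?thesis
    using e[of 0] e[of 1] by (simp add: numeral_eq_Suc)
qed

lemma digit_0: "d < N \<Longrightarrow> digit (c * N + d) 0 = d"
  by (simp add: digit_def)

lemma digit_Suc: "d < N \<Longrightarrow> digit (c * N + d) (Suc k) = digit c k"
  by (simp add: digit_def div_mult2_eq)

lemmas digit_simps = digit_0 digit_Suc numeral_eq_Suc

definition entry :: "nat \<Rightarrow> nat \<Rightarrow> nat \<Rightarrow> nat \<Rightarrow> nat" where
  "entry m p q j = fact (p + q + j) div (fact p * fact q * fact j) * a j * E q (m - (p + q + j))"

text \<open>The content of a table cell after \<open>x\<close> rounds. The row \<open>r\<close> is
  the length and the column \<open>c\<close> the number of excursions, so the final value is
  \<open>E c r\<close>. The 1 at the origin is the initial entry \<open>E 0 0\<close>.\<close>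

definition part :: "nat \<Rightarrow> nat \<Rightarrow> nat \<Rightarrow> nat" where
  "part x r c = (if r = 0 \<and> c = 0 then 1 else 0) +
     (\<Sum>y<x. if digit y 2 + digit y 1 + digit y 0 \<le> digit y 3 \<and> r = Suc (digit y 3) \<and> c = Suc (digit y 2)
       then entry (digit y 3) (digit y 2) (digit y 1) (digit y 0) else 0)"

text \<open>The length is the most significant digit of the counter, so row \<open>r\<close>
  receives its last contribution before round \<open>r * N ^ 3\<close>.\<close>

lemma part_complete:
  assumes "r \<le> N" "c \<le> N" "x \<le> N ^ 4" "r * N ^ 3 \<le> x"
  shows "part x r c = E c r"
proof (cases "r = 0 \<or> c = 0")
  case True
  then show ?thesis by (cases c; cases r) (auto simp: part_def E_0 E_Suc_0)
next
  case False
  then obtain m p where mp: "r = Suc m" "c = Suc p" by (metis not0_implies_Suc)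
  then have le: "m < N" "p < N" using assms by auto
  let ?A = "{y\<in>{..<x}. digit y 2 + digit y 1 + digit y 0 \<le> digit y 3 \<and>
    r = Suc (digit y 3) \<and> c = Suc (digit y 2)}"
  have "part x r c = (\<Sum>y\<in>?A. entry (digit y 3) (digit y 2) (digit y 1) (digit y 0))"
    unfolding part_def using False by (subst sum.inter_filter) auto
  also have "\<dots> = (\<Sum>(q, j) | p + q + j \<le> m. entry m p q j)"
  proof (rule sum.reindex_bij_witness[where j = "\<lambda>y. (digit y 1, digit y 0)"
        and i = "\<lambda>(q, j). ((m * N + p) * N + q) * N + j"])
    fix y assume y: "y \<in> ?A"
    then have "y < N ^ 4" using assms by auto
    from expand4[OF this] y mp
    show "(case (digit y 1, digit y 0) of (q, j) \<Rightarrow> ((m * N + p) * N + q) * N + j) = y" by auto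
    show "(digit y 1, digit y 0) \<in> {(q, j). p + q + j \<le> m}" using y mp by auto
    show "(case (digit y 1, digit y 0) of (q, j) \<Rightarrow> entry m p q j) =
      entry (digit y 3) (digit y 2) (digit y 1) (digit y 0)" using y mp by auto
  next
    fix qj assume qj: "qj \<in> {(q, j). p + q + j \<le> m}"
    then obtain q j where q: "qj = (q, j)" "p + q + j \<le> m" by auto
    let ?y = "((m * N + p) * N + q) * N + j"
    have l: "q < N" "j < N" using q le by auto
    have d: "digit ?y 0 = j" "digit ?y 1 = q" "digit ?y 2 = p" "digit ?y 3 = m"
      using l le by (simp_all add: digit_simps) (simp add: digit_def)
    have "?y < Suc m * N ^ 3"
    proof -
      have "m * N + p < Suc m * N" using le by simp
      then have "(m * N + p) * N + q < Suc m * N * N"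
        using l by (metis Suc_leI add.commute add_strict_left_mono less_le_trans mult_Suc mult_le_mono1)
      then have "?y < Suc m * N * N * N"
        using l by (metis Suc_leI add.commute add_strict_left_mono less_le_trans mult_Suc mult_le_mono1)
      then show ?thesis by (simp only: power3_eq_cube mult.assoc)
    qed
    then have "?y < x" using assms(4) mp by simp
    then show "(case qj of (q, j) \<Rightarrow> ((m * N + p) * N + q) * N + j) \<in> ?A"
      using q d mp by auto
    show "(digit (case qj of (q, j) \<Rightarrow> ((m * N + p) * N + q) * N + j) 1,
        digit (case qj of (q, j) \<Rightarrow> ((m * N + p) * N + q) * N + j) 0) = qj"
      using q d by auto
  qed
  also have "\<dots> = E c r" by (simp add: mp E_Suc_Suc entry_def)
  finally show ?thesis .
qed

text \<open>Summands are natural numbers, so a partial sum is at most the complete one, which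
  \<open>E_le\<close> bounds.\<close>

lemma part_le:
  assumes "r \<le> N" "c \<le> N" "x \<le> N ^ 4"
  shows "part x r c \<le> V"
proof -
  have "part x r c \<le> part (N ^ 4) r c"
    unfolding part_def by (intro add_left_mono sum_mono2) (use assms(3) in auto)
  also have "\<dots> = E c r"
    by (rule part_complete) (use assms in \<open>auto simp: power_add[of N 1 3, simplified]\<close>)
  also have "\<dots> \<le> V" using assms(1) by (intro E_le) (simp add: N_def)
  finally show ?thesis .
qed

definition result_part :: "nat \<Rightarrow> nat \<Rightarrow> nat" where
  "result_part x k = (\<Sum>y<x. if digit y 0 \<le> k \<and> digit y 1 \<le> k \<and> k = digit y 2
       then E (Suc (digit y 1)) (Suc (digit y 0)) * E (digit y 1) (k - digit y 0) else 0)"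

lemma result_part_complete:
  assumes "k \<le> n"
  shows "result_part (N ^ 3) k = f k"
proof -
  let ?A = "{y\<in>{..<N ^ 3}. digit y 0 \<le> k \<and> digit y 1 \<le> k \<and> k = digit y 2}"
  have "result_part (N ^ 3) k =
      (\<Sum>y\<in>?A. E (Suc (digit y 1)) (Suc (digit y 0)) * E (digit y 1) (k - digit y 0))"
    unfolding result_part_def by (subst sum.inter_filter) auto
  also have "\<dots> = (\<Sum>(p, m) \<in> {..k} \<times> {..k}. E (Suc p) (Suc m) * E p (k - m))"
  proof (rule sum.reindex_bij_witness[where j = "\<lambda>y. (digit y 1, digit y 0)"
        and i = "\<lambda>(p, m). (k * N + p) * N + m"])
    fix y assume y: "y \<in> ?A"
    then have "y < N ^ 3" by auto
    from expand3[OF this] y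
    show "(case (digit y 1, digit y 0) of (p, m) \<Rightarrow> (k * N + p) * N + m) = y" by auto
    show "(digit y 1, digit y 0) \<in> {..k} \<times> {..k}" using y by auto
  next
    fix pm assume "pm \<in> {..k} \<times> {..k}"
    then obtain p m where pm: "pm = (p, m)" "p \<le> k" "m \<le> k" by auto
    let ?y = "(k * N + p) * N + m"
    have l: "p < N" "m < N" "k < N" using pm assms by (auto simp: N_def)
    have d: "digit ?y 0 = m" "digit ?y 1 = p" "digit ?y 2 = k"
      using l by (simp_all add: digit_simps) (simp add: digit_def)
    have "?y < N ^ 3"
    proof -
      have "k * N + p < Suc k * N" using l by simp
      also have "\<dots> \<le> N * N" using l by (intro mult_le_mono1) simp
      finally have "(k * N + p) * N + m < N * N * N"
        using l by (metis Suc_leI add.commute add_strict_left_mono less_le_trans mult_Suc mult_le_mono1)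
      then show ?thesis by (simp add: power3_eq_cube)
    qed
    then show "(case pm of (p, m) \<Rightarrow> (k * N + p) * N + m) \<in> ?A" using d pm by auto
    show "(digit (case pm of (p, m) \<Rightarrow> (k * N + p) * N + m) 1,
        digit (case pm of (p, m) \<Rightarrow> (k * N + p) * N + m) 0) = pm" using d pm by auto
  qed auto
  also have "\<dots> = f k" by (rule f_eq[symmetric])
  finally show ?thesis .
qed

lemma result_part_le: "k \<le> n \<Longrightarrow> x \<le> N ^ 3 \<Longrightarrow> result_part x k \<le> V"
proof -
  assume "k \<le> n" "x \<le> N ^ 3"
  then have "result_part x k \<le> result_part (N ^ 3) k"
    unfolding result_part_def by (intro sum_mono2) auto
  also have "\<dots> \<le> V" using \<open>k \<le> n\<close> by (simp add: result_part_complete f_le)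
  finally show ?thesis .
qed

subsection \<open>Correctness of the loops\<close>

definition input_ok :: "mem \<Rightarrow> bool" where
  "input_ok m \<longleftrightarrow> (\<forall>j\<le>n. m (Suc j) = a j)"

definition facts_ok :: "nat \<Rightarrow> mem \<Rightarrow> bool" where
  "facts_ok x m \<longleftrightarrow> (\<forall>i\<le>x. m (w + i) = fact i)"

definition table_ok :: "(nat \<Rightarrow> nat \<Rightarrow> nat) \<Rightarrow> mem \<Rightarrow> bool" where
  "table_ok t m \<longleftrightarrow> (\<forall>r\<le>N. \<forall>c\<le>N. m ((r + 3) * w + c) = t r c)"

definition result_ok :: "(nat \<Rightarrow> nat) \<Rightarrow> mem \<Rightarrow> bool" where
  "result_ok g m \<longleftrightarrow> (\<forall>k\<le>n. m (2 * w + k) = g k)"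

text \<open>The regions are disjoint: input below \<open>w\<close>, factorials in row 1, results in
  row 2, table from \<open>3 * w\<close> on.\<close>

lemma frame_update:
  shows input_ok_update: "w \<le> i \<Longrightarrow> input_ok (m(i := y)) \<longleftrightarrow> input_ok m"
    and facts_ok_update:
      "i < w \<or> 2 * w \<le> i \<Longrightarrow> x \<le> n \<Longrightarrow> facts_ok x (m(i := y)) \<longleftrightarrow> facts_ok x m"
    and result_ok_update: "i < 2 * w \<or> 3 * w \<le> i \<Longrightarrow> result_ok g (m(i := y)) \<longleftrightarrow> result_ok g m"
    and table_ok_update: "i < 3 * w \<Longrightarrow> table_ok t (m(i := y)) \<longleftrightarrow> table_ok t m"
proof -
  have "Suc k \<noteq> i" if "w \<le> i" "k \<le> n" for k
    using that by (simp add: w_def)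
  then show "w \<le> i \<Longrightarrow> input_ok (m(i := y)) \<longleftrightarrow> input_ok m"
    by (simp add: input_ok_def)
  have "w + k \<noteq> i" if "i < w \<or> 2 * w \<le> i" "k \<le> n" for k
    using that n_less by linarith
  then show "i < w \<or> 2 * w \<le> i \<Longrightarrow> x \<le> n \<Longrightarrow> facts_ok x (m(i := y)) \<longleftrightarrow> facts_ok x m"
    unfolding facts_ok_def by (metis fun_upd_other order_trans)
  have "2 * w + k \<noteq> i" if "i < 2 * w \<or> 3 * w \<le> i" "k \<le> n" for k
    using that n_less by linarith
  then show "i < 2 * w \<or> 3 * w \<le> i \<Longrightarrow> result_ok g (m(i := y)) \<longleftrightarrow> result_ok g m"
    unfolding result_ok_def by (metis fun_upd_other)
  have "(r + 3) * w + c \<noteq> i" if "i < 3 * w" for r c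
    using that unfolding add_mult_distrib by linarith
  then show "i < 3 * w \<Longrightarrow> table_ok t (m(i := y)) \<longleftrightarrow> table_ok t m"
    unfolding table_ok_def by (metis fun_upd_other)
qed

text \<open>The counter sits in the last cell of row 0, directly behind the inputs in cells 1 to
  \<open>n + 1\<close>.\<close>

lemma frame_counter:
  "input_ok (m(n + 2 := y)) \<longleftrightarrow> input_ok m"
  "x \<le> n \<Longrightarrow> facts_ok x (m(n + 2 := y)) \<longleftrightarrow> facts_ok x m"
  "result_ok g (m(n + 2 := y)) \<longleftrightarrow> result_ok g m"
  "table_ok t (m(n + 2 := y)) \<longleftrightarrow> table_ok t m"
  using frame_update(2-4)[of "n + 2"] by (simp_all add: input_ok_def w_def)

lemma clear_loop:
  "correct V (\<lambda>m. m 0 = n \<and> input_ok m)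
     (for_prog (Mul width_e width_e) (Store clear_addr (Const 0)))
     (Suc (w * w) * for_steps (Mul width_e width_e) (store_steps clear_addr (Const 0)))
     (\<lambda>m. m 0 = n \<and> input_ok m \<and> (\<forall>y<w * w. m (2 * w + y) = 0))"
proof (rule correct_mono[OF correct_for[where I = "\<lambda>x m. input_ok m \<and> (\<forall>y<x. m (2 * w + y) = 0)"]])
  fix x assume x: "x < w * w"
  show "correct V (\<lambda>m. m 0 = n \<and> m (n + 2) = x \<and> input_ok m \<and> (\<forall>y<x. m (2 * w + y) = 0))
    (Store clear_addr (Const 0)) (store_steps clear_addr (Const 0))
    (\<lambda>m. m 0 = n \<and> m (n + 2) = x \<and> input_ok m \<and> (\<forall>y<Suc x. m (2 * w + y) = 0))"
    by (rule correct_Store) (auto simp: input_ok_def w_def less_Suc_eq)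
next
  show "w * w \<le> V" using pow_le(1) w4_le by simp
qed (auto simp: input_ok_def w_def)

lemma init_table:
  "correct V (\<lambda>m. m 0 = n \<and> input_ok m \<and> (\<forall>y<w * w. m (2 * w + y) = 0))
     (Store (cell (Const 3) (Const 0)) (Const 1)) (store_steps (cell (Const 3) (Const 0)) (Const 1))
     (\<lambda>m. m 0 = n \<and> input_ok m \<and> result_ok (result_part 0) m \<and> table_ok (part 0) m)"
proof (rule correct_Store)
  fix m assume m: "m 0 = n \<and> input_ok m \<and> (\<forall>y<w * w. m (2 * w + y) = 0)"
  let ?m = "m(3 * w := 1)"
  \<comment> \<open>Since \<open>N + 2 = w\<close>, the block of \<open>w * w\<close> cleared cells
    consists of rows 2 to \<open>N + 3\<close>.\<close>
  have z: "m (r * w + c) = 0" if "2 \<le> r" "r \<le> N + 3" "c \<le> N" for r c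
  proof -
    obtain r' where r: "r = 2 + r'" using \<open>2 \<le> r\<close> le_Suc_ex by blast
    have "r' * w + c < Suc r' * w" using that(3) n_less by simp
    also have "\<dots> \<le> w * w" using that(2) r by (intro mult_le_mono1) (simp add: w_def N_def)
    finally have "m (2 * w + (r' * w + c)) = 0"
      by (rule m[THEN conjunct2, THEN conjunct2, rule_format])
    moreover have "2 * w + (r' * w + c) = r * w + c" using r by (simp add: add_mult_distrib)
    ultimately show ?thesis by simp
  qed
  have "?m 0 = n" "input_ok ?m" using m n_less by (simp_all add: frame_update)
  moreover have "result_ok (result_part 0) ?m"
    using z[of 2] n_less by (auto simp: result_ok_def result_part_def N_def w_def)
  moreover have "table_ok (part 0) ?m"
    unfolding table_ok_def
  proof (intro allI impI)
    fix r c assume rc: "r \<le> N" "c \<le> N"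
    have "(r + 3) * w + c = 3 * w \<longleftrightarrow> r = 0 \<and> c = 0"
      using cell_eq_iff[of c 0 "r + 3" 3] rc n_less by simp
    then show "?m ((r + 3) * w + c) = part 0 r c"
      using z[of "r + 3" c] rc by (auto simp: part_def)
  qed
  moreover have "1 \<le> V" using pow_le(5) w4_le by simp
  moreover have v: "val (cell (Const 3) (Const 0)) m = 3 * w" "val (Const 1) m = 1"
    using m by (simp_all add: w_def)
  ultimately show "val (Const 1) m \<le> V \<and> (\<lambda>m. m 0 = n \<and> input_ok m \<and>
      result_ok (result_part 0) m \<and> table_ok (part 0) m)
      (m(val (cell (Const 3) (Const 0)) m := val (Const 1) m))"
    unfolding v by blast
qed

lemma init_facts:
  "correct V (\<lambda>m. m 0 = n \<and> input_ok m \<and> result_ok g m \<and> table_ok t m)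
     (Store (cell (Const 1) (Const 0)) (Const 1)) (store_steps (cell (Const 1) (Const 0)) (Const 1))
     (\<lambda>m. m 0 = n \<and> input_ok m \<and> facts_ok 0 m \<and> result_ok g m \<and> table_ok t m)"
proof (rule correct_Store)
  fix m assume m: "m 0 = n \<and> input_ok m \<and> result_ok g m \<and> table_ok t m"
  then have "(m(w := 1)) 0 = n" "input_ok (m(w := 1))" "facts_ok 0 (m(w := 1))"
    "result_ok g (m(w := 1))" "table_ok t (m(w := 1))"
    using n_less by (simp_all add: frame_update facts_ok_def)
  moreover have "1 \<le> V" using pow_le(5) w4_le by simp
  moreover have v: "val (cell (Const 1) (Const 0)) m = w" "val (Const 1) m = 1"
    using m by (simp_all add: w_def)
  ultimately show "val (Const 1) m \<le> V \<and>
      (\<lambda>m. m 0 = n \<and> input_ok m \<and> facts_ok 0 m \<and> result_ok g m \<and> table_ok t m)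
      (m(val (cell (Const 1) (Const 0)) m := val (Const 1) m))"
    unfolding v by blast
qed

lemma fact_loop:
  "correct V (\<lambda>m. m 0 = n \<and> input_ok m \<and> facts_ok 0 m \<and> result_ok g m \<and> table_ok t m)
     (for_prog size_e (Store (cell (Const 1) (Add counter (Const 1)))
        (Mul (fact_e counter) (Add counter (Const 1)))))
     (Suc n * for_steps size_e (store_steps (cell (Const 1) (Add counter (Const 1)))
        (Mul (fact_e counter) (Add counter (Const 1)))))
     (\<lambda>m. m 0 = n \<and> input_ok m \<and> facts_ok n m \<and> result_ok g m \<and> table_ok t m)"
proof (rule correct_for[where I = "\<lambda>x m. input_ok m \<and> facts_ok x m \<and> result_ok g m \<and> table_ok t m"])
  fix x assume x: "x < n"
  show "correct V (\<lambda>m. m 0 = n \<and> m (n + 2) = x \<and> input_ok m \<and> facts_ok x m \<and> result_ok g m \<and> table_ok t m)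
    (Store (cell (Const 1) (Add counter (Const 1))) (Mul (fact_e counter) (Add counter (Const 1))))
    (store_steps (cell (Const 1) (Add counter (Const 1))) (Mul (fact_e counter) (Add counter (Const 1))))
    (\<lambda>m. m 0 = n \<and> m (n + 2) = x \<and> input_ok m \<and> facts_ok (Suc x) m \<and> result_ok g m \<and> table_ok t m)"
  proof (rule correct_Store)
    fix m assume m: "m 0 = n \<and> m (n + 2) = x \<and> input_ok m \<and> facts_ok x m \<and> result_ok g m \<and> table_ok t m"
    let ?m = "m(w + Suc x := fact (Suc x))"
    have lt: "w + Suc x < 2 * w" using x by (simp add: w_def)
    have "?m 0 = n" using m n_less by simp
    moreover have "?m (n + 2) = x" using m by (simp add: w_def)
    moreover have "input_ok ?m" "result_ok g ?m" "table_ok t ?m"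
      using m lt by (simp_all add: frame_update)
    moreover have "facts_ok (Suc x) ?m" using m by (simp add: facts_ok_def le_Suc_eq)
    moreover have v: "val (Mul (fact_e counter) (Add counter (Const 1))) m = fact (Suc x)"
      using m by (auto simp: facts_ok_def w_def)
    moreover have v': "val (cell (Const 1) (Add counter (Const 1))) m = w + Suc x"
      using m by (auto simp: w_def)
    moreover have "fact (Suc x) \<le> V" using x by (intro fact_le) simp
    ultimately show "val (Mul (fact_e counter) (Add counter (Const 1))) m \<le> V \<and>
      (\<lambda>m. m 0 = n \<and> m (n + 2) = x \<and> input_ok m \<and> facts_ok (Suc x) m \<and> result_ok g m \<and> table_ok t m)
      (m(val (cell (Const 1) (Add counter (Const 1))) m :=
        val (Mul (fact_e counter) (Add counter (Const 1))) m))"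
      unfolding v v' by blast
  qed
next
  show "n \<le> V" using pow_le(4) w4_le by (simp add: w_def)
qed (simp_all only: frame_counter val.simps)

lemma val_digit: "m 0 = n \<Longrightarrow> m (n + 2) = x \<Longrightarrow> val (digit_e k) m = digit x k"
  by (simp add: val_digit_e digit_def N_def)

lemma table_loop:
  "correct V (\<lambda>m. m 0 = n \<and> input_ok m \<and> facts_ok n m \<and> result_ok g m \<and> table_ok (part 0) m)
     (for_prog base4_e (accumulate (leq_e sum_e (digit_e 3)) table_addr table_term))
     (Suc (N ^ 4) * for_steps base4_e (accumulate_steps (leq_e sum_e (digit_e 3)) table_addr table_term))
     (\<lambda>m. m 0 = n \<and> input_ok m \<and> facts_ok n m \<and> result_ok g m \<and> table_ok (part (N ^ 4)) m)"
proof (rule correct_for[where I = "\<lambda>x m. input_ok m \<and> facts_ok n m \<and> result_ok g m \<and> table_ok (part x) m"])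
  fix x assume x: "x < N ^ 4"
  let ?d = "digit x"
  have d: "?d k \<le> n" for k by (rule digit_le)
  show "correct V (\<lambda>m. m 0 = n \<and> m (n + 2) = x \<and> input_ok m \<and> facts_ok n m \<and> result_ok g m \<and> table_ok (part x) m)
    (accumulate (leq_e sum_e (digit_e 3)) table_addr table_term)
    (accumulate_steps (leq_e sum_e (digit_e 3)) table_addr table_term)
    (\<lambda>m. m 0 = n \<and> m (n + 2) = x \<and> input_ok m \<and> facts_ok n m \<and> result_ok g m \<and> table_ok (part (Suc x)) m)"
  proof (rule correct_accumulate)
    fix m assume m: "m 0 = n \<and> m (n + 2) = x \<and> input_ok m \<and> facts_ok n m \<and> result_ok g m \<and> table_ok (part x) m"
      and b: "val (leq_e sum_e (digit_e 3)) m \<noteq> 0"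
    have v: "val (digit_e k) m = ?d k" for k by (rule val_digit) (use m in auto)
    have s: "?d 2 + ?d 1 + ?d 0 \<le> ?d 3" using b by (simp add: v sum_e_def)
    have addr: "val table_addr m = (Suc (?d 3) + 3) * w + Suc (?d 2)"
      using m by (simp add: table_addr_def v w_def)
    have fa: "m (w + i) = fact i" if "i \<le> n" for i using m that by (simp add: facts_ok_def)
    have tab: "m ((r + 3) * w + c) = part x r c" if "r \<le> N" "c \<le> N" for r c
      using m that by (simp add: table_ok_def)
    \<comment> \<open>The row read has index at most \<open>?d 3\<close>, with equality if the other
      digits vanish. All rounds before \<open>?d 3 * N ^ 3\<close> are over, so this row is
      complete, whereas the current round writes to row \<open>Suc (?d 3)\<close>.\<close>
    have rd: "m ((?d 3 - (?d 2 + ?d 1 + ?d 0) + 3) * w + ?d 1) = E (?d 1) (?d 3 - (?d 2 + ?d 1 + ?d 0))"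
    proof -
      have "(?d 3 - (?d 2 + ?d 1 + ?d 0)) * N ^ 3 \<le> ?d 3 * N ^ 3" by (intro mult_le_mono1) simp
      also have "\<dots> \<le> x"
        using x by (simp add: digit_def less_mult_imp_div_less numeral_eq_Suc)
      finally show ?thesis
        using d[of 1] d[of 3] x by (subst tab) (auto simp: part_complete N_def)
    qed
    have e: "val table_term m = entry (?d 3) (?d 2) (?d 1) (?d 0)"
    proof -
      have "val (fact_e sum_e) m = fact (?d 2 + ?d 1 + ?d 0)"
        using fa[of "?d 2 + ?d 1 + ?d 0"] s d[of 3] m by (simp add: v sum_e_def w_def)
      moreover have "val (fact_e (digit_e k)) m = fact (?d k)" for k
        using fa[OF d[of k]] m by (simp add: v w_def)
      moreover have "val (Load (Add (digit_e 0) (Const 1))) m = a (?d 0)"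
        using m d[of 0] by (simp add: v input_ok_def)
      moreover have "val (table_e (Sub (digit_e 3) sum_e) (digit_e 1)) m =
          E (?d 1) (?d 3 - (?d 2 + ?d 1 + ?d 0))"
        using rd m by (simp add: v sum_e_def w_def)
      ultimately show ?thesis
        unfolding table_term_def entry_def val.simps(5,6) by simp
    qed
    have new: "part (Suc x) r c = part x r c +
        (if r = Suc (?d 3) \<and> c = Suc (?d 2) then entry (?d 3) (?d 2) (?d 1) (?d 0) else 0)" for r c
      using s by (simp add: part_def)
    let ?a = "(Suc (?d 3) + 3) * w + Suc (?d 2)"
    let ?m = "m(?a := m ?a + entry (?d 3) (?d 2) (?d 1) (?d 0))"
    have old: "m ?a = part x (Suc (?d 3)) (Suc (?d 2))"
      using d[of 3] d[of 2] by (intro tab) (auto simp: N_def)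
    have "m ?a + entry (?d 3) (?d 2) (?d 1) (?d 0) = part (Suc x) (Suc (?d 3)) (Suc (?d 2))"
      unfolding old new by simp
    also have "\<dots> \<le> V" using d[of 3] d[of 2] x by (intro part_le) (auto simp: N_def)
    finally have le: "m ?a + entry (?d 3) (?d 2) (?d 1) (?d 0) \<le> V" .
    have "table_ok (part (Suc x)) ?m"
      unfolding table_ok_def
    proof (intro allI impI)
      fix r c assume rc: "r \<le> N" "c \<le> N"
      have "(r + 3) * w + c = ?a \<longleftrightarrow> r = Suc (?d 3) \<and> c = Suc (?d 2)"
        using cell_eq_iff[of c "Suc (?d 2)" "r + 3" "Suc (?d 3) + 3"] rc d[of 2] by (auto simp: w_def N_def)
      then show "?m ((r + 3) * w + c) = part (Suc x) r c"
        using tab[OF rc] old new[of r c] by auto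
    qed
    moreover have big: "3 * w \<le> ?a" by (simp add: add_mult_distrib)
    moreover have "?m 0 = n" "?m (n + 2) = x" using m big n_less by auto
    moreover have "input_ok ?m" "facts_ok n ?m" "result_ok g ?m"
      using m big by (simp_all add: frame_update)
    ultimately show "m (val table_addr m) + val table_term m \<le> V \<and>
      (\<lambda>m. m 0 = n \<and> m (n + 2) = x \<and> input_ok m \<and> facts_ok n m \<and> result_ok g m \<and> table_ok (part (Suc x)) m)
        (m(val table_addr m := m (val table_addr m) + val table_term m))"
      unfolding addr e using le by blast
  next
    fix m assume m: "m 0 = n \<and> m (n + 2) = x \<and> input_ok m \<and> facts_ok n m \<and> result_ok g m \<and> table_ok (part x) m"
      and b: "val (leq_e sum_e (digit_e 3)) m = 0"
    have v: "val (digit_e k) m = ?d k" for k by (rule val_digit) (use m in auto)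
    have "\<not> ?d 2 + ?d 1 + ?d 0 \<le> ?d 3" using b by (simp add: v sum_e_def)
    then have "part (Suc x) = part x" by (auto simp: part_def fun_eq_iff)
    then show "m 0 = n \<and> m (n + 2) = x \<and> input_ok m \<and> facts_ok n m \<and> result_ok g m \<and> table_ok (part (Suc x)) m"
      using m by simp
  qed
next
  show "N ^ 4 \<le> V" using pow_le(2) w4_le by (rule order_trans)
  show "val base4_e m = N ^ 4" if "m 0 = n" for m
    using that by (simp add: base4_e_def base3_e_def N_def numeral_eq_Suc)
qed (simp only: frame_counter)

lemma result_loop:
  "correct V (\<lambda>m. m 0 = n \<and> table_ok (part (N ^ 4)) m \<and> result_ok (result_part 0) m)
     (for_prog base3_e (accumulate result_test result_addr result_term))
     (Suc (N ^ 3) * for_steps base3_e (accumulate_steps result_test result_addr result_term))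
     (\<lambda>m. m 0 = n \<and> table_ok (part (N ^ 4)) m \<and> result_ok (result_part (N ^ 3)) m)"
proof (rule correct_for[where I = "\<lambda>x m. table_ok (part (N ^ 4)) m \<and> result_ok (result_part x) m"])
  fix x assume x: "x < N ^ 3"
  let ?d = "digit x"
  have d: "?d k \<le> n" for k by (rule digit_le)
  show "correct V (\<lambda>m. m 0 = n \<and> m (n + 2) = x \<and> table_ok (part (N ^ 4)) m \<and> result_ok (result_part x) m)
    (accumulate result_test result_addr result_term)
    (accumulate_steps result_test result_addr result_term)
    (\<lambda>m. m 0 = n \<and> m (n + 2) = x \<and> table_ok (part (N ^ 4)) m \<and> result_ok (result_part (Suc x)) m)"
  proof (rule correct_accumulate)
    fix m assume m: "m 0 = n \<and> m (n + 2) = x \<and> table_ok (part (N ^ 4)) m \<and> result_ok (result_part x) m"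
      and b: "val result_test m \<noteq> 0"
    have v: "val (digit_e k) m = ?d k" for k by (rule val_digit) (use m in auto)
    have s: "?d 0 \<le> ?d 2" "?d 1 \<le> ?d 2" using b by (simp_all add: v result_test_def)
    have addr: "val result_addr m = 2 * w + ?d 2"
      using m by (simp add: result_addr_def v w_def)
    have tab: "m ((r + 3) * w + c) = E c r" if "r \<le> N" "c \<le> N" for r c
    proof -
      have "r * N ^ 3 \<le> N ^ 4" using that by (simp add: power_add[of N 1 3, simplified])
      then show ?thesis using m that part_complete[of r c "N ^ 4"] by (simp add: table_ok_def)
    qed
    \<comment> \<open>The indices \<open>Suc (?d 0)\<close> and \<open>Suc (?d 1)\<close> can reach
      \<open>n + 1\<close>; this is why the table extends to \<open>N\<close> in both
      directions.\<close>
    have e: "val result_term m = E (Suc (?d 1)) (Suc (?d 0)) * E (?d 1) (?d 2 - ?d 0)"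
      using tab[of "Suc (?d 0)" "Suc (?d 1)"] tab[of "?d 2 - ?d 0" "?d 1"] d[of 0] d[of 1] d[of 2] m
      by (simp add: result_term_def v w_def N_def)
    let ?e = "E (Suc (?d 1)) (Suc (?d 0)) * E (?d 1) (?d 2 - ?d 0)"
    let ?m = "m(2 * w + ?d 2 := m (2 * w + ?d 2) + ?e)"
    have old: "m (2 * w + k) = result_part x k" if "k \<le> n" for k
      using m that by (simp add: result_ok_def)
    have new: "result_part (Suc x) k = result_part x k + (if k = ?d 2 then ?e else 0)" for k
      using s by (simp add: result_part_def)
    have le: "m (2 * w + ?d 2) + ?e \<le> V"
      using result_part_le[of "?d 2" "Suc x"] x d[of 2] by (simp add: old new)
    have "result_ok (result_part (Suc x)) ?m"
      unfolding result_ok_def using old new d by auto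
    moreover have "2 * w + ?d 2 < 3 * w" using d[of 2] n_less by simp
    then have "?m 0 = n" "?m (n + 2) = x" "table_ok (part (N ^ 4)) ?m"
      using m n_less by (auto simp: frame_update)
    ultimately show "m (val result_addr m) + val result_term m \<le> V \<and>
      (\<lambda>m. m 0 = n \<and> m (n + 2) = x \<and> table_ok (part (N ^ 4)) m \<and> result_ok (result_part (Suc x)) m)
        (m(val result_addr m := m (val result_addr m) + val result_term m))"
      unfolding addr e using le by blast
  next
    fix m assume m: "m 0 = n \<and> m (n + 2) = x \<and> table_ok (part (N ^ 4)) m \<and> result_ok (result_part x) m"
      and b: "val result_test m = 0"
    have v: "val (digit_e k) m = ?d k" for k by (rule val_digit) (use m in auto)
    have "\<not> (?d 0 \<le> ?d 2 \<and> ?d 1 \<le> ?d 2)" using b by (auto simp: v result_test_def)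
    then have "result_part (Suc x) = result_part x" by (auto simp: result_part_def fun_eq_iff)
    then show "m 0 = n \<and> m (n + 2) = x \<and> table_ok (part (N ^ 4)) m \<and> result_ok (result_part (Suc x)) m"
      using m by simp
  qed
next
  show "N ^ 3 \<le> V" using pow_le(3) w4_le by (rule order_trans)
  show "val base3_e m = N ^ 3" if "m 0 = n" for m
    using that by (simp add: base3_e_def N_def numeral_eq_Suc)
qed (simp only: frame_counter)

lemma copy_loop:
  "correct V (\<lambda>m. m 0 = n \<and> result_ok f m)
     (for_prog base_e (Store (Add counter (Const 1)) (Load (cell (Const 2) counter))))
     (Suc N * for_steps base_e (store_steps (Add counter (Const 1)) (Load (cell (Const 2) counter))))
     (\<lambda>m. m 0 = n \<and> (\<forall>k\<le>n. m (Suc k) = f k))"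
proof (rule correct_mono[OF correct_for[where I = "\<lambda>x m. result_ok f m \<and> (\<forall>k<x. m (Suc k) = f k)" and X = N]])
  fix x assume x: "x < N"
  show "correct V (\<lambda>m. m 0 = n \<and> m (n + 2) = x \<and> result_ok f m \<and> (\<forall>k<x. m (Suc k) = f k))
    (Store (Add counter (Const 1)) (Load (cell (Const 2) counter)))
    (store_steps (Add counter (Const 1)) (Load (cell (Const 2) counter)))
    (\<lambda>m. m 0 = n \<and> m (n + 2) = x \<and> result_ok f m \<and> (\<forall>k<Suc x. m (Suc k) = f k))"
  proof (rule correct_Store)
    fix m assume m: "m 0 = n \<and> m (n + 2) = x \<and> result_ok f m \<and> (\<forall>k<x. m (Suc k) = f k)"
    have xn: "x \<le> n" "Suc x < 2 * w" using x by (simp_all add: N_def w_def)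
    have v: "val (Load (cell (Const 2) counter)) m = f x" "val (Add counter (Const 1)) m = Suc x"
      using m xn by (simp_all add: result_ok_def w_def)
    moreover have "f x \<le> V" using x by (intro f_le) (simp add: N_def)
    moreover have "(m(Suc x := f x)) 0 = n" "(m(Suc x := f x)) (n + 2) = x"
      "result_ok f (m(Suc x := f x))" "\<forall>k<Suc x. (m(Suc x := f x)) (Suc k) = f k"
      using m xn by (simp_all add: frame_update less_Suc_eq)
    ultimately show "val (Load (cell (Const 2) counter)) m \<le> V \<and>
      (\<lambda>m. m 0 = n \<and> m (n + 2) = x \<and> result_ok f m \<and> (\<forall>k<Suc x. m (Suc k) = f k))
        (m(val (Add counter (Const 1)) m := val (Load (cell (Const 2) counter)) m))"
      unfolding v by blast
  qed
next
  show "N \<le> V" using pow_le(4) w4_le n_less by simp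
  show "result_ok f (m(n + 2 := y)) \<and> (\<forall>k<x. (m(n + 2 := y)) (Suc k) = f k) \<longleftrightarrow>
     result_ok f m \<and> (\<forall>k<x. m (Suc k) = f k)" if "x \<le> N" for x y m
    using that frame_counter(3)[of f m y] by (auto simp: N_def)
qed (auto simp: N_def)

lemma wreath_prog_correct:
  "correct V (\<lambda>m. m 0 = n \<and> (\<forall>j\<le>n. m (Suc j) = a j)) wreath_prog (step_factor * (n + 3) ^ 4)
     (\<lambda>m. m 0 = n \<and> (\<forall>k\<le>n. m (Suc k) = f k))"
proof -
  have copy: "correct V (\<lambda>m. m 0 = n \<and> table_ok (part (N ^ 4)) m \<and> result_ok (result_part (N ^ 3)) m)
     (for_prog base_e (Store (Add counter (Const 1)) (Load (cell (Const 2) counter))))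
     (Suc N * for_steps base_e (store_steps (Add counter (Const 1)) (Load (cell (Const 2) counter))))
     (\<lambda>m. m 0 = n \<and> (\<forall>k\<le>n. m (Suc k) = f k))"
    by (rule correct_mono[OF copy_loop]) (auto simp: result_ok_def result_part_complete)
  have res: "correct V (\<lambda>m. m 0 = n \<and> input_ok m \<and> facts_ok n m \<and> result_ok (result_part 0) m \<and>
        table_ok (part (N ^ 4)) m)
     (for_prog base3_e (accumulate result_test result_addr result_term))
     (Suc (N ^ 3) * for_steps base3_e (accumulate_steps result_test result_addr result_term))
     (\<lambda>m. m 0 = n \<and> table_ok (part (N ^ 4)) m \<and> result_ok (result_part (N ^ 3)) m)"
    by (rule correct_mono[OF result_loop]) auto
  note all = correct_Seq[OF clear_loop correct_Seq[OF init_table correct_Seq[OF init_facts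
      correct_Seq[OF fact_loop correct_Seq[OF table_loop correct_Seq[OF res copy]]]]]]
  have le: "Suc (w * w) \<le> 2 * w ^ 4" "Suc n \<le> 2 * w ^ 4" "Suc (N ^ 4) \<le> 2 * w ^ 4"
    "Suc (N ^ 3) \<le> 2 * w ^ 4" "Suc N \<le> 2 * w ^ 4" "1 \<le> 2 * w ^ 4"
    using pow_le n_less by linarith+
  have mult: "x \<le> 2 * w ^ 4 \<Longrightarrow> x * k \<le> 2 * k * w ^ 4" for x k
    using mult_le_mono1[of x "2 * w ^ 4" k] by (simp add: mult_ac)
  have steps: "Suc (w * w) * k1 + (k2 + (k3 + (Suc n * k4 + (Suc (N ^ 4) * k5 +
      (Suc (N ^ 3) * k6 + Suc N * k7))))) \<le> 2 * (k1 + k2 + k3 + k4 + k5 + k6 + k7) * w ^ 4"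
    for k1 k2 k3 k4 k5 k6 k7
    using mult[OF le(1), of k1] mult[OF le(6), of k2] mult[OF le(6), of k3] mult[OF le(2), of k4]
      mult[OF le(3), of k5] mult[OF le(4), of k6] mult[OF le(5), of k7]
    unfolding add_mult_distrib add_mult_distrib2 mult_1 by linarith
  show ?thesis
    unfolding wreath_prog_def step_factor_def w_def[symmetric]
    by (rule correct_mono[OF all _ steps]) (simp_all add: input_ok_def)
qed

end

section \<open>Polynomial running time\<close>

text \<open>The exponent is large enough to cover \<open>c ^ (n + 1)\<close>, \<open>n!\<close> and \<open>(n + 3) ^ 4\<close>.\<close>

definition cell_bound :: "nat \<Rightarrow> nat \<Rightarrow> nat" where
  "cell_bound c n = 2 ^ (c * (n + 5) ^ 2)"

lemma power_le_cell_bound: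
  assumes "d \<le> c" "m \<le> Suc n"
  shows "d ^ m \<le> cell_bound c n"
proof -
  have "d ^ m \<le> (2 ^ c) ^ m"
    using assms(1) by (intro power_mono) (auto intro: le_trans less_imp_le[OF less_exp])
  also have "\<dots> \<le> 2 ^ (c * (n + 5) ^ 2)"
    unfolding power_mult[symmetric]
    using assms(2) by (intro power_increasing mult_le_mono2) (auto simp: power2_eq_square algebra_simps)
  finally show ?thesis by (simp add: cell_bound_def)
qed

text \<open>From \<open>i! \<le> i ^ i \<le> 2 ^ (n * n)\<close>. The factorials are the reason for
  a quadratic exponent; the counts of words grow with a linear one.\<close>

lemma fact_le_cell_bound:
  assumes "c > 0" "i \<le> n"
  shows "fact i \<le> cell_bound c n"
proof -
  have "fact i \<le> i ^ i" using fact_le_power[of i, where 'a = nat] by (simp only: of_nat_id)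
  also have "\<dots> \<le> (2 ^ n) ^ i"
    using assms(2) by (intro power_mono) (auto intro: le_trans less_imp_le[OF less_exp])
  also have "\<dots> \<le> (2 ^ n) ^ n"
    using assms(2) by (intro power_increasing) auto
  also have "\<dots> \<le> 2 ^ (c * (n + 5) ^ 2)"
    unfolding power_mult[symmetric]
  proof (intro power_increasing)
    have "n * n \<le> 1 * (n + 5) ^ 2" by (simp add: power2_eq_square algebra_simps)
    also have "\<dots> \<le> c * (n + 5) ^ 2" using assms(1) by (intro mult_le_mono1) simp
    finally show "n * n \<le> c * (n + 5) ^ 2" .
  qed simp
  finally show ?thesis by (simp add: cell_bound_def)
qed

lemma size_le_cell_bound:
  assumes "c > 0"
  shows "(n + 3) ^ 4 \<le> cell_bound c n"
proof -
  have "(n + 3) ^ 4 \<le> (2 ^ (n + 3)) ^ 4"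
    by (intro power_mono) (auto intro: less_imp_le[OF less_exp])
  also have "\<dots> \<le> 2 ^ (c * (n + 5) ^ 2)"
    unfolding power_mult[symmetric]
  proof (intro power_increasing)
    have "(n + 3) * 4 \<le> 1 * (n + 5) ^ 2" by (simp add: power2_eq_square algebra_simps)
    also have "\<dots> \<le> c * (n + 5) ^ 2" using assms(1) by (intro mult_le_mono1) simp
    finally show "(n + 3) * 4 \<le> c * (n + 5) ^ 2" .
  qed simp
  finally show ?thesis by (simp add: cell_bound_def)
qed

lemma less_cell_bound:
  assumes "c > 0"
  shows "n + 2 \<le> cell_bound c n"
  using self_le_power[of "n + 3" 4] size_le_cell_bound[OF assms, of n] by simp

text \<open>Leaving \<open>c\<close> free above the size of the alphabet allows one bound to be
  shared by consecutive runs for different groups.\<close>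

lemma correct_wreath_prog:
  assumes G: "group G" and S: "finite S" "S \<subseteq> carrier G" and z: "z = 1 \<or> z = - 1"
    and c: "card (symmetric_gens G S) + 2 \<le> c"
  shows "correct (cell_bound c n) (\<lambda>m. m 0 = n \<and> (\<forall>j\<le>n. m (Suc j) = num_loops G S j)) wreath_prog
    (step_factor * (n + 3) ^ 4)
    (\<lambda>m. m 0 = n \<and> (\<forall>k\<le>n. m (Suc k) = num_loops (wreath_Z G) (wreath_gens G z S) k))"
proof -
  interpret language "symmetric_gens G S" "identity_words G S"
    using S(1) by (rule language_identity_words)
  have num: "num = num_loops G S"
    by (auto simp: num_def num_loops_def identity_words_length fun_eq_iff)
  have c0: "c > 0" using c by simp
  interpret tables n "cell_bound c n" "num_loops G S" "\<lambda>k. card (closed_paths k)"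
    "\<lambda>p m. card (closed_words p m)"
  proof
    show "card (closed_words (Suc p) (Suc m)) =
      (\<Sum>(q, j) | p + q + j \<le> m. fact (p + q + j) div (fact p * fact q * fact j) * num_loops G S j *
        card (closed_words q (m - (p + q + j))))" for p m
      unfolding card_closed_words_Suc_Suc card_open_words num ..
    show "card (closed_words p m) \<le> cell_bound c n" if "m \<le> Suc n" for p m
      using card_closed_words_le power_le_cell_bound[OF c that] by (rule le_trans)
    show "card (closed_paths k) \<le> cell_bound c n" if "k \<le> n" for k
      using card_closed_paths_le power_le_cell_bound[OF c le_SucI[OF that]] by (rule le_trans)
  qed (simp_all add: card_closed_words_0 card_closed_words_Suc_0 card_closed_paths
      fact_le_cell_bound size_le_cell_bound c0)
  show ?thesis
    using wreath_prog_correct unfolding num_loops_wreath_Z[OF G S z] .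
qed

section \<open>Output layout and polynomial time\<close>

lemma num_loops_0: "num_loops H T 0 = 1"
proof -
  have "loops H T 0 = {[]}" by (auto simp: loops_def)
  then show ?thesis by (simp add: num_loops_def)
qed

text \<open>The output is expected from cell 0 on, one cell further left than
  \<open>wreath_prog\<close> leaves it. Cell 0 holds \<open>n\<close>, which the loop needs, so it
  is overwritten last, with the number 1 of loops of length 0.\<close>

definition output_prog :: prog where
  "output_prog = Seq (for_prog size_e (Store (Add counter (Const 1)) (Load (Add counter (Const 2)))))
     (Store (Const 0) (Const 1))"

definition output_factor :: nat where
  "output_factor = for_steps size_e (store_steps (Add counter (Const 1)) (Load (Add counter (Const 2)))) +
     store_steps (Const 0) (Const 1)"

lemma correct_output_prog:
  assumes V: "n + 2 \<le> V" and g: "g 0 = 1"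
  shows "correct V (\<lambda>m. m 0 = n \<and> (\<forall>k\<le>n. m (Suc k) = g k)) output_prog
    (output_factor * (n + 3) ^ 4) (\<lambda>m. \<forall>k\<le>n. m k = g k)"
proof -
  \<comment> \<open>After \<open>x\<close> rounds, cells 1 to \<open>x\<close> hold moved values,
    and cells \<open>x + 1\<close> to \<open>n + 1\<close> are still in the old layout. Moving
    upwards in order never destroys a value not yet read.\<close>
  let ?I = "\<lambda>x m. (\<forall>k. 0 < k \<and> k \<le> x \<longrightarrow> m k = g k) \<and> (\<forall>k. x \<le> k \<and> k \<le> n \<longrightarrow> m (Suc k) = g k)"
  let ?K = "store_steps (Add counter (Const 1)) (Load (Add counter (Const 2)))"
  have loop: "correct V (\<lambda>m. m 0 = n \<and> ?I 0 m)
      (for_prog size_e (Store (Add counter (Const 1)) (Load (Add counter (Const 2)))))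
      (Suc n * for_steps size_e ?K) (\<lambda>m. m 0 = n \<and> ?I n m)"
  proof (rule correct_for[where I = ?I])
    fix x assume x: "x < n"
    show "correct V (\<lambda>m. m 0 = n \<and> m (n + 2) = x \<and> ?I x m)
      (Store (Add counter (Const 1)) (Load (Add counter (Const 2)))) ?K
      (\<lambda>m. m 0 = n \<and> m (n + 2) = x \<and> ?I (Suc x) m)"
    proof (rule correct_Store)
      fix m assume m: "m 0 = n \<and> m (n + 2) = x \<and> ?I x m" and b: "bounded V m"
      let ?m = "m(Suc x := g (Suc x))"
      have nx: "m (Suc (Suc x)) = g (Suc x)" using m x by simp
      then have le: "g (Suc x) \<le> V" using b by (metis bounded_def)
      have v: "val (Load (Add counter (Const 2))) m = g (Suc x)" "val (Add counter (Const 1)) m = Suc x"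
        using m nx by simp_all
      have "?m 0 = n" "?m (n + 2) = x" using m x by simp_all
      moreover have "?I (Suc x) ?m" using m by (auto simp: le_Suc_eq)
      ultimately show "val (Load (Add counter (Const 2))) m \<le> V \<and>
        (\<lambda>m. m 0 = n \<and> m (n + 2) = x \<and> ?I (Suc x) m)
          (m(val (Add counter (Const 1)) m := val (Load (Add counter (Const 2))) m))"
        unfolding v using le by blast
    qed
  next
    show "n \<le> V" using V by simp
  qed auto
  have fin: "correct V (\<lambda>m. m 0 = n \<and> ?I n m) (Store (Const 0) (Const 1))
      (store_steps (Const 0) (Const 1)) (\<lambda>m. \<forall>k\<le>n. m k = g k)"
    by (rule correct_Store) (use V g in auto)
  have "Suc n \<le> n + 3" "1 \<le> (n + 3)" by simp_all
  moreover have "n + 3 \<le> (n + 3) ^ 4" by (rule self_le_power) auto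
  ultimately have p: "Suc n \<le> (n + 3) ^ 4" "1 \<le> (n + 3) ^ 4" by linarith+
  have "Suc n * k1 \<le> k1 * (n + 3) ^ 4" for k1
    using mult_le_mono1[OF p(1), of k1] by (simp only: mult.commute)
  moreover have "k2 \<le> k2 * (n + 3) ^ 4" for k2
    using mult_le_mono2[OF p(2), of k2] by (simp only: mult_1_right)
  ultimately have le: "Suc n * k1 + k2 \<le> (k1 + k2) * (n + 3) ^ 4" for k1 k2
    unfolding add_mult_distrib by (meson add_mono)
  show ?thesis
    unfolding output_prog_def output_factor_def
    by (rule correct_mono[OF correct_Seq[OF loop fin] _ le]) auto
qed

text \<open>The polynomial is the number of units times the length of a unit; the last factor comes
  from the number of digits of \<open>cell_bound c n\<close>, at most
  \<open>c * (n + 5) ^ 2 + 1\<close>.\<close>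

lemma computes_in_poly_timeI:
  assumes prg: "\<And>n. correct (cell_bound c n) (P n) prg (K * (n + 3) ^ 4) (\<lambda>m. \<forall>k\<le>n. m k = num_loops H T k)"
    and init: "\<And>n. P n (init_mem (inp n))" "\<And>n. bounded (cell_bound c n) (init_mem (inp n))"
  shows "computes_in_poly_time prg inp (cogrowth_upto H T)"
  unfolding computes_in_poly_time_def computes_in_time_def
proof (intro exI[of _ "[:K:] * [:3, 1:] ^ 4 * ([:c:] * [:5, 1:] ^ 2 + [:2:])"] allI)
  fix n
  obtain t m where tm: "exec prg (init_mem (inp n)) t m" "t \<le> K * (n + 3) ^ 4 * (bits (cell_bound c n) + 1)"
    "\<forall>k\<le>n. m k = num_loops H T k"
    using prg[of n] init[of n] unfolding correct_def by blast
  have "bits (cell_bound c n) \<le> c * (n + 5) ^ 2 + 1"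
    unfolding cell_bound_def by (rule bits_le) simp
  then have "K * (n + 3) ^ 4 * (bits (cell_bound c n) + 1) \<le> K * (n + 3) ^ 4 * (c * (n + 5) ^ 2 + 2)"
    by (intro mult_le_mono2) simp
  also have "\<dots> = poly ([:K:] * [:3, 1:] ^ 4 * ([:c:] * [:5, 1:] ^ 2 + [:2:])) n"
    by (simp add: poly_power algebra_simps)
  finally have "t \<le> poly ([:K:] * [:3, 1:] ^ 4 * ([:c:] * [:5, 1:] ^ 2 + [:2:])) n"
    using tm(2) by linarith
  moreover have "map m [0..<length (cogrowth_upto H T n)] = cogrowth_upto H T n"
    using tm(3) by (auto simp: cogrowth_upto_def)
  ultimately show "\<exists>t m. exec prg (init_mem (inp n)) t m \<and>
      map m [0..<length (cogrowth_upto H T n)] = cogrowth_upto H T n \<and>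
      t \<le> poly ([:K:] * [:3, 1:] ^ 4 * ([:c:] * [:5, 1:] ^ 2 + [:2:])) n"
    using tm(1) by blast
qed

text \<open>Shared by the general claim and the examples: \<open>prg\<close> is whatever brings the
  loop numbers of the base group into the input cells.\<close>

lemma computes_wreath_after:
  assumes before: "\<And>n. correct (cell_bound c n) (P n) prg (K * (n + 3) ^ 4)
      (\<lambda>m. m 0 = n \<and> (\<forall>j\<le>n. m (Suc j) = num_loops G S j))"
    and G: "group G" "finite S" "S \<subseteq> carrier G" "z = 1 \<or> z = - 1" "card (symmetric_gens G S) + 2 \<le> c"
    and init: "\<And>n. P n (init_mem (inp n))" "\<And>n. bounded (cell_bound c n) (init_mem (inp n))"
  shows "computes_in_poly_time (Seq prg (Seq wreath_prog output_prog)) inp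
    (cogrowth_upto (wreath_Z G) (wreath_gens G z S))"
proof (rule computes_in_poly_timeI[where P = P, OF _ init])
  fix n
  have "n + 2 \<le> cell_bound c n" using G(5) by (intro less_cell_bound) simp
  note out = correct_output_prog[where g = "num_loops (wreath_Z G) (wreath_gens G z S)", OF this num_loops_0]
  show "correct (cell_bound c n) (P n) (Seq prg (Seq wreath_prog output_prog))
      ((K + (step_factor + output_factor)) * (n + 3) ^ 4)
      (\<lambda>m. \<forall>k\<le>n. m k = num_loops (wreath_Z G) (wreath_gens G z S) k)"
    unfolding add_mult_distrib
    by (rule correct_Seq[OF before correct_Seq[OF correct_wreath_prog[OF G] out]])
qed

lemma finite_wreath_gens: "finite S \<Longrightarrow> finite (wreath_gens G z S)"
  by (simp add: wreath_gens_def)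

lemma num_loops_le: "finite S \<Longrightarrow> num_loops G S j \<le> (card (symmetric_gens G S) + 2) ^ j"
  using language.num_le[OF language_identity_words, of S G j]
  by (simp add: language.num_def[OF language_identity_words] identity_words_length num_loops_def)

lemma generator_integer_group:
  assumes "finite_generating_set integer_group {z}"
  shows "z = 1 \<or> z = - 1"
proof -
  have "1 \<in> generate integer_group {z}" using assms by (simp add: finite_generating_set_def)
  then obtain k :: int where "1 = k * z"
    by (auto simp: group.generate_pow[OF group_integer_group])
  then show ?thesis using zmult_eq_1_iff[of k z] by auto
qed

text \<open>The input list already has the layout that \<open>wreath_prog\<close> expects, so the
  preparation is \<open>Skip\<close>.\<close>

lemma computes_wreath:
  assumes G: "group G" "finite_generating_set G S" "finite_generating_set integer_group {z}"
  shows "computes_in_poly_time (Seq Skip (Seq wreath_prog output_prog)) (\<lambda>n. n # cogrowth_upto G S n)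
    (cogrowth_upto (wreath_Z G) (wreath_gens G z S))"
proof (rule computes_wreath_after[OF _ G(1) _ _ generator_integer_group[OF G(3)] order_refl])
  let ?P = "\<lambda>n m. m 0 = n \<and> (\<forall>j\<le>n. m (Suc j) = num_loops G S j)"
  let ?c = "card (symmetric_gens G S) + 2"
  show S: "finite S" "S \<subseteq> carrier G" using G(2) by (auto simp: finite_generating_set_def)
  fix n :: nat
  have "(n + 3) ^ 4 \<ge> 1" by (rule one_le_power) simp
  then have "1 \<le> 1 * (n + 3) ^ 4 * (bits (cell_bound ?c n) + 1)"
    using mult_le_mono[of 1 "(n + 3) ^ 4" 1 "bits (cell_bound ?c n) + 1"] by simp
  then show "correct (cell_bound ?c n) (?P n) Skip (1 * (n + 3) ^ 4) (?P n)"
    using exec.Skip unfolding correct_def by blast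
  show "?P n (init_mem (n # cogrowth_upto G S n))"
    by (auto simp: init_mem_def cogrowth_upto_def nth_append simp del: upt_Suc)
  show "bounded (cell_bound ?c n) (init_mem (n # cogrowth_upto G S n))"
    unfolding bounded_def
  proof
    fix i
    have "n \<le> cell_bound ?c n" using less_cell_bound[of ?c n] by simp
    moreover have "num_loops G S j \<le> cell_bound ?c n" if "j \<le> n" for j
      using num_loops_le[OF S(1)] power_le_cell_bound[of ?c ?c j n] that by (meson le_SucI le_trans order_refl)
    ultimately show "init_mem (n # cogrowth_upto G S n) i \<le> cell_bound ?c n"
      by (cases i) (auto simp: init_mem_def cogrowth_upto_def simp del: upt_Suc)
  qed
qed

section \<open>The examples\<close>

lemma init_mem_singleton: "init_mem [n] 0 = n" "init_mem [n] (Suc j) = 0"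
  by (simp_all add: init_mem_def)

lemma bounded_init_mem_singleton: "c > 0 \<Longrightarrow> bounded (cell_bound c n) (init_mem [n])"
  using less_cell_bound[of c n] by (auto simp: bounded_def init_mem_def)

text \<open>The generator is its own inverse, so the alphabet has a single letter and there is one
  word of each length.\<close>

lemma loops_mod_2: "loops (integer_mod_group 2) {1} k = (if even k then {replicate k 1} else {})"
proof -
  have inv: "inv\<^bsub>integer_mod_group 2\<^esub> 1 = 1"
    by (simp add: carrier_integer_mod_group)
  have "foldr (\<otimes>\<^bsub>integer_mod_group 2\<^esub>) (replicate k 1) 0 = int k mod 2" for k
    by (induction k) (auto simp: mod_simps)
  then have fold: "foldr (\<otimes>\<^bsub>integer_mod_group 2\<^esub>) (replicate k 1) 0 = 0 \<longleftrightarrow> even k" for k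
    by presburger
  have words: "length w = k \<and> set w \<subseteq> {1} \<longleftrightarrow> w = replicate k 1" for w :: "int list"
    by (auto intro!: replicate_eqI)
  have "loops (integer_mod_group 2) {1} k =
      {w. (length w = k \<and> set w \<subseteq> {1}) \<and> foldr (\<otimes>\<^bsub>integer_mod_group 2\<^esub>) w 0 = 0}"
    by (simp add: loops_def inv del: mult_integer_mod_group)
  also have "\<dots> = {w. w = replicate k 1 \<and> even k}"
    unfolding words using fold by blast
  finally show ?thesis by auto
qed

lemma num_loops_mod_2: "num_loops (integer_mod_group 2) {1} k = 1 - k mod 2"
  by (auto simp: num_loops_def loops_mod_2 odd_iff_mod_2_eq_one)

definition parity_prog :: prog where
  "parity_prog = for_prog base_e (Store (Add counter (Const 1)) (Sub (Const 1) (mod_e counter (Const 2))))"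

lemma correct_parity_prog:
  assumes V: "n + 2 \<le> V"
  shows "correct V (\<lambda>m. m 0 = n) parity_prog
    (for_steps base_e (store_steps (Add counter (Const 1)) (Sub (Const 1) (mod_e counter (Const 2)))) * (n + 3) ^ 4)
    (\<lambda>m. m 0 = n \<and> (\<forall>k\<le>n. m (Suc k) = num_loops (integer_mod_group 2) {1} k))"
proof -
  let ?I = "\<lambda>x m. \<forall>k<x. m (Suc k) = 1 - k mod 2"
  let ?K = "store_steps (Add counter (Const 1)) (Sub (Const 1) (mod_e counter (Const 2)))"
  have loop: "correct V (\<lambda>m. m 0 = n \<and> ?I 0 m) parity_prog
      (Suc (Suc n) * for_steps base_e ?K) (\<lambda>m. m 0 = n \<and> ?I (Suc n) m)"
    unfolding parity_prog_def
  proof (rule correct_for[where I = ?I])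
    fix x assume x: "x < Suc n"
    show "correct V (\<lambda>m. m 0 = n \<and> m (n + 2) = x \<and> ?I x m)
      (Store (Add counter (Const 1)) (Sub (Const 1) (mod_e counter (Const 2)))) ?K
      (\<lambda>m. m 0 = n \<and> m (n + 2) = x \<and> ?I (Suc x) m)"
      by (rule correct_Store) (use x V in \<open>auto simp: less_Suc_eq\<close>)
  qed (use V in auto)
  have "Suc (Suc n) \<le> n + 3" by simp
  also have "n + 3 \<le> (n + 3) ^ 4" by (rule self_le_power) auto
  finally have "Suc (Suc n) \<le> (n + 3) ^ 4" .
  from mult_le_mono1[OF this] have "Suc (Suc n) * k \<le> k * (n + 3) ^ 4" for k
    by (simp only: mult.commute)
  then show ?thesis
    by (rule correct_mono[OF loop, rotated]) (auto simp: num_loops_mod_2)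
qed

lemma poly_time_lamplighter:
  "poly_time_cogrowth (wreath_Z (integer_mod_group 2)) (wreath_gens (integer_mod_group 2) 1 {1})"
  unfolding poly_time_cogrowth_def
proof
  let ?c = "card (symmetric_gens (integer_mod_group 2) {1}) + 2"
  show "computes_in_poly_time (Seq parity_prog (Seq wreath_prog output_prog)) (\<lambda>n. [n])
     (cogrowth_upto (wreath_Z (integer_mod_group 2)) (wreath_gens (integer_mod_group 2) 1 {1}))"
  proof (rule computes_wreath_after[where c = ?c, OF correct_parity_prog])
    show "n + 2 \<le> cell_bound ?c n" for n by (rule less_cell_bound) simp
  qed (auto simp: init_mem_singleton bounded_init_mem_singleton carrier_integer_mod_group)
qed

text \<open>The trivial group without generators has one loop of length 0 and no others. On memory
  that is zero behind cell 0, storing a single 1 provides these numbers.\<close>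

definition integer_prog :: prog where
  "integer_prog = Seq (Store (Const 1) (Const 1)) wreath_prog"

definition integer_factor :: nat where
  "integer_factor = store_steps (Const 1) (Const 1) + step_factor"

lemma correct_integer_prog:
  assumes c: "card (symmetric_gens (singleton_group ()) {}) + 2 \<le> c"
  shows "correct (cell_bound c n) (\<lambda>m. m 0 = n \<and> (\<forall>j. m (Suc j) = 0)) integer_prog
    (integer_factor * (n + 3) ^ 4)
    (\<lambda>m. m 0 = n \<and> (\<forall>k\<le>n. m (Suc k) = num_loops integer_group {1} k))"
proof -
  let ?G = "singleton_group ()"
  have num: "num_loops ?G {} j = (if j = 0 then 1 else 0)" for j
    using num_loops_0[of ?G "{}"] by (auto simp: num_loops_def loops_def card_eq_0_iff)
  have "n + 2 \<le> cell_bound c n" using c by (intro less_cell_bound) simp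
  then have store: "correct (cell_bound c n) (\<lambda>m. m 0 = n \<and> (\<forall>j. m (Suc j) = 0)) (Store (Const 1) (Const 1))
      (store_steps (Const 1) (Const 1)) (\<lambda>m. m 0 = n \<and> (\<forall>j\<le>n. m (Suc j) = num_loops ?G {} j))"
    by (intro correct_Store) (auto simp: num)
  have wr: "correct (cell_bound c n) (\<lambda>m. m 0 = n \<and> (\<forall>j\<le>n. m (Suc j) = num_loops ?G {} j)) wreath_prog
      (step_factor * (n + 3) ^ 4) (\<lambda>m. m 0 = n \<and> (\<forall>k\<le>n. m (Suc k) = num_loops integer_group {1} k))"
    unfolding num_loops_integer_group
    by (rule correct_wreath_prog) (use c in auto)
  have "1 \<le> (n + 3) ^ 4" by (rule one_le_power) simp
  from mult_le_mono2[OF this, of "store_steps (Const 1) (Const 1)"]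
  show ?thesis
    unfolding integer_prog_def integer_factor_def
    by (intro correct_mono[OF correct_Seq[OF store wr]]) (auto simp: add_mult_distrib)
qed

lemma poly_time_integer_wreath:
  "poly_time_cogrowth (wreath_Z integer_group) (wreath_gens integer_group 1 {1})"
  unfolding poly_time_cogrowth_def
proof
  let ?c = "card (symmetric_gens (singleton_group ()) {}) + card (symmetric_gens integer_group {1}) + 2"
  show "computes_in_poly_time (Seq integer_prog (Seq wreath_prog output_prog)) (\<lambda>n. [n])
     (cogrowth_upto (wreath_Z integer_group) (wreath_gens integer_group 1 {1}))"
    by (rule computes_wreath_after[where c = ?c, OF correct_integer_prog])
      (auto simp: init_mem_singleton bounded_init_mem_singleton)
qed

lemma poly_time_integer_wreath_wreath:
  "poly_time_cogrowth (wreath_Z (wreath_Z integer_group))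
     (wreath_gens (wreath_Z integer_group) 1 (wreath_gens integer_group 1 {1}))"
  unfolding poly_time_cogrowth_def
proof
  let ?S = "wreath_gens integer_group 1 {1}"
  \<comment> \<open>All three runs share one cell bound, so \<open>c\<close> has to dominate the
    alphabet sizes of all three base groups; their sum does.\<close>
  let ?c = "card (symmetric_gens (singleton_group ()) {}) + card (symmetric_gens integer_group {1}) +
    card (symmetric_gens (wreath_Z integer_group) ?S) + 2"
  have prg: "correct (cell_bound ?c n) (\<lambda>m. m 0 = n \<and> (\<forall>j. m (Suc j) = 0)) (Seq integer_prog wreath_prog)
      ((integer_factor + step_factor) * (n + 3) ^ 4)
      (\<lambda>m. m 0 = n \<and> (\<forall>k\<le>n. m (Suc k) = num_loops (wreath_Z integer_group) ?S k))" for n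
    unfolding add_mult_distrib
    by (rule correct_Seq[OF correct_integer_prog correct_wreath_prog]) auto
  show "computes_in_poly_time (Seq (Seq integer_prog wreath_prog) (Seq wreath_prog output_prog)) (\<lambda>n. [n])
     (cogrowth_upto (wreath_Z (wreath_Z integer_group)) (wreath_gens (wreath_Z integer_group) 1 ?S))"
    by (rule computes_wreath_after[OF prg])
      (simp_all add: init_mem_singleton bounded_init_mem_singleton group_wreath_Z finite_wreath_gens
        wreath_gens_closed)
qed

theorem mainTheorem4:
  shows "(\<exists>P. \<forall>(G :: ('a, 'b) monoid_scheme) S z.
            group G \<and> finite_generating_set G S \<and> finite_generating_set integer_group {z} \<longrightarrow>
            computes_in_poly_time P
              (\<lambda>n. n # cogrowth_upto G S n)
              (cogrowth_upto (wreath_Z G) (wreath_gens G z S)))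
       \<and> poly_time_cogrowth
            (wreath_Z (integer_mod_group 2))
            (wreath_gens (integer_mod_group 2) 1 {1})
       \<and> poly_time_cogrowth
            (wreath_Z integer_group)
            (wreath_gens integer_group 1 {1})
       \<and> poly_time_cogrowth
            (wreath_Z (wreath_Z integer_group))
            (wreath_gens (wreath_Z integer_group) 1 (wreath_gens integer_group 1 {1}))"
\<comment> \<open>The witness is the same program for all \<open>G\<close>, \<open>S\<close> and
  \<open>z\<close>; only the polynomial inside \<open>computes_in_poly_time\<close> may vary with
  them.\<close>
proof (intro conjI exI[of _ "Seq Skip (Seq wreath_prog output_prog)"] allI impI)
qed (auto intro: computes_wreath poly_time_lamplighter poly_time_integer_wreath
    poly_time_integer_wreath_wreath)

end
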